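(* Let $\Omega\subset\mathbb{R}^N$ be open, let $U$ be an open subset of $\Omega$, and let $k\in\mathbb{N}$ be such that $1\le k<N$. Then $U$ satisfies condition (C$_{k,\Omega,U}$) if and only if $U$ satisfies condition (G$_{\lambda_{N-k},\Omega,U}$).
   Context: For a real symmetric $N\times N$ matrix $X$, $\lambda_1(X)\le\dots\le\lambda_N(X)$ denote its eigenvalues in nondecreasing order. Condition (G$_{\lambda_{j},\Omega,U}$): if $\phi\in C^2(\Omega)$, $\hat x\in\Omega\setminus U$ and $\phi\le\phi(\hat x)=0$ in $\Omega\setminus U$, then $\lambda_{j}(D^2\phi(\hat x))\le 0$. $B_r^m$ and $\overline B_r^m$ denote the open and closed balls of radius $r$ centered at the origin in $\mathbb{R}^m$. For $z\in\mathbb{R}^N$, $a>0$, $b>0$ and an orthogonal $N\times N$ matrix $O$, consider the set $C=z+O\big(\overline B_a^k\times\overline B_b^{N-k}\big)$ and its lateral boundary $\partial' C=z+O\big(\partial B_a^k\times\overline B_b^{N-k}\big)$. The collection of all such $C$ is denoted $\mathcal{C}_{k,N-k}$. Condition (C$_{k,\Omega,U}$): for every such $C\in\mathcal{C}_{k,N-k}$ (with its $\partial' C$), if $C\subset\Omega$ and $\partial' C\cup\operatorname{int}C\subset U$, then $C\subset U$. *)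

theory Defs
  imports
    "HOL-Analysis.Analysis"
    "HOL-Computational_Algebra.Polynomial"
begin

section \<open>Ordered eigenvalues\<close>

definition charpoly :: "real^'n^'n \<Rightarrow> real poly" where
  "charpoly X = det (mat [:0, 1:] - map_matrix (\<lambda>c. [:c:]) X)"

text \<open>
  The real roots of the characteristic polynomial, with multiplicity, in nondecreasing order.
  For a symmetric matrix these are all the eigenvalues, so the list has length \<open>CARD('n)\<close>.
\<close>
definition eigenvalues :: "real^'n^'n \<Rightarrow> real list" where
  "eigenvalues X = sorted_list_of_multiset (proots (charpoly X))"

text \<open>The indices \<open>j = 1, \<dots>, CARD('n)\<close> are meaningful, and only for symmetric \<open>X\<close>.\<close>
definition eigval :: "nat \<Rightarrow> real^'n^'n \<Rightarrow> real" where
  "eigval j X = eigenvalues X ! (j - 1)"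


section \<open>Functions of class \<open>C\<^sup>2\<close> and Hessians\<close>

definition partial :: "'n \<Rightarrow> (real^'n \<Rightarrow> real) \<Rightarrow> real^'n \<Rightarrow> real" where
  "partial i f x = frechet_derivative f (at x) (axis i 1)"

definition hessian :: "(real^'n \<Rightarrow> real) \<Rightarrow> real^'n \<Rightarrow> real^'n^'n" where
  "hessian f x = (\<chi> i j. partial i (partial j f) x)"

text \<open>
  Intended for open \<open>\<Omega>\<close>, where \<^const>\<open>differentiable_on\<close> is differentiability at every point
  of \<open>\<Omega>\<close>, so that the partial derivatives of first and second order are genuine.
\<close>
definition C2_on :: "(real^'n) set \<Rightarrow> (real^'n \<Rightarrow> real) \<Rightarrow> bool" where
  "C2_on \<Omega> f \<longleftrightarrow>
     f differentiable_on \<Omega> \<and>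
     (\<forall>i. partial i f differentiable_on \<Omega>) \<and>
     (\<forall>i j. continuous_on \<Omega> (partial i (partial j f)))"

definition cond_G :: "nat \<Rightarrow> (real^'n) set \<Rightarrow> (real^'n) set \<Rightarrow> bool" where
  "cond_G j \<Omega> U \<longleftrightarrow>
     (\<forall>\<phi> x. C2_on \<Omega> \<phi> \<and> x \<in> \<Omega> - U \<and> (\<forall>y\<in>\<Omega> - U. \<phi> y \<le> \<phi> x) \<and> \<phi> x = 0
        \<longrightarrow> eigval j (hessian \<phi> x) \<le> 0)"


section \<open>Cylinders\<close>

text \<open>
  The factorization of \<open>real^'n\<close> into \<open>k\<close> and \<open>CARD('n) - k\<close> coordinates is given by a set \<open>K\<close>
  of \<open>k\<close> indices, since \<open>'n\<close> carries no order. The Euclidean norms of the two components of \<open>x\<close>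
  are \<open>L2_set (($) x) K\<close> and \<open>L2_set (($) x) (- K)\<close>.
\<close>
definition cylinder ::
    "real^'n \<Rightarrow> real^'n^'n \<Rightarrow> 'n set \<Rightarrow> real \<Rightarrow> real \<Rightarrow> (real^'n) set" where
  "cylinder z Q K a b =
     (\<lambda>x. z + Q *v x) ` {x. L2_set (($) x) K \<le> a \<and> L2_set (($) x) (- K) \<le> b}"

definition lateral_boundary ::
    "real^'n \<Rightarrow> real^'n^'n \<Rightarrow> 'n set \<Rightarrow> real \<Rightarrow> real \<Rightarrow> (real^'n) set" where
  "lateral_boundary z Q K a b =
     (\<lambda>x. z + Q *v x) ` {x. L2_set (($) x) K = a \<and> L2_set (($) x) (- K) \<le> b}"

definition cond_C :: "nat \<Rightarrow> (real^'n) set \<Rightarrow> (real^'n) set \<Rightarrow> bool" where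
  "cond_C k \<Omega> U \<longleftrightarrow>
     (\<forall>z Q K a b.
        orthogonal_matrix Q \<and> card K = k \<and> 0 < a \<and> 0 < b \<and>
        cylinder z Q K a b \<subseteq> \<Omega> \<and>
        lateral_boundary z Q K a b \<union> interior (cylinder z Q K a b) \<subseteq> U
        \<longrightarrow> cylinder z Q K a b \<subseteq> U)"

text \<open>The choice of \<open>K\<close> does not matter: a permutation matrix can be absorbed into \<open>Q\<close>.\<close>
lemma cylinder_change_coordinates:
  fixes K K' :: "'n::finite set" and Q :: "real^'n^'n"
  assumes Q: "orthogonal_matrix Q" and card: "card K = card K'"
  obtains Q' where "orthogonal_matrix Q'"
    and "\<And>z a b. cylinder z Q K a b = cylinder z Q' K' a b"
    and "\<And>z a b. lateral_boundary z Q K a b = lateral_boundary z Q' K' a b"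
proof -
  obtain f where f: "bij_betw f K K'"
    using card by (metis finite_same_card_bij finite)
  have "card (- K) = card (- K')"
    by (simp add: card Compl_eq_Diff_UNIV card_Diff_subset)
  then obtain g where g: "bij_betw g (- K) (- K')"
    by (metis finite_same_card_bij finite)
  define p where "p i = (if i \<in> K then f i else g i)" for i
  have pK: "bij_betw p K K'"
    using f by (subst bij_betw_cong[where g = f]) (auto simp: p_def)
  have pK': "bij_betw p (- K) (- K')"
    using g by (subst bij_betw_cong[where g = g]) (auto simp: p_def)
  have "bij_betw p (K \<union> - K) (K' \<union> - K')"
    by (rule bij_betw_combine[OF pK pK']) auto
  then have p: "bij p" by simp
  define P where "P = (\<chi> i j. if j = p i then 1 else 0 :: real^'n^'n)"
  have Pv: "(P *v x) $ i = x $ p i" for x i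
    by (simp add: P_def matrix_vector_mult_def if_distrib[of "\<lambda>t. t * _"] cong: if_cong)
  have "orthogonal_transformation ((*v) P)"
    unfolding orthogonal_transformation_def
    using p by (auto simp: inner_vec_def Pv bij_def
        intro!: sum.reindex_bij_betw[of p UNIV UNIV "\<lambda>i. _ $ i * _ $ i"])
  then have P: "orthogonal_matrix P"
    by (simp add: orthogonal_transformation_matrix)
  have eq: "L2_set (($) (P *v x)) K = L2_set (($) x) K'"
    "L2_set (($) (P *v x)) (- K) = L2_set (($) x) (- K')" for x
    using sum.reindex_bij_betw[OF pK, of "\<lambda>i. (x $ i)\<^sup>2"]
      sum.reindex_bij_betw[OF pK', of "\<lambda>i. (x $ i)\<^sup>2"]
    by (simp_all add: L2_set_def Pv)
  have inv: "P *v (transpose P *v x) = x" for x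
    using P unfolding matrix_vector_mul_assoc orthogonal_matrix_def
    by (simp only: matrix_vector_mul_lid)
  have img: "(\<lambda>x. z + Q *v x) ` {x. R (L2_set (($) x) K) (L2_set (($) x) (- K))} =
      (\<lambda>x. z + (Q ** P) *v x) ` {x. R (L2_set (($) x) K') (L2_set (($) x) (- K'))}"
    (is "?L = ?R") for R :: "real \<Rightarrow> real \<Rightarrow> bool" and z
  proof
    show "?L \<subseteq> ?R"
    proof
      fix y assume "y \<in> ?L"
      then obtain x where x: "y = z + Q *v x" "R (L2_set (($) x) K) (L2_set (($) x) (- K))"
        by blast
      define w where "w = transpose P *v x"
      have "x = P *v w" by (simp only: w_def inv)
      then have "y = z + (Q ** P) *v w" "R (L2_set (($) w) K') (L2_set (($) w) (- K'))"
        using x by (simp_all only: eq matrix_vector_mul_assoc)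
      then show "y \<in> ?R" by blast
    qed
    show "?R \<subseteq> ?L"
    proof
      fix y assume "y \<in> ?R"
      then obtain w where w: "y = z + (Q ** P) *v w"
          "R (L2_set (($) w) K') (L2_set (($) w) (- K'))"
        by blast
      then have "y = z + Q *v (P *v w)"
          "R (L2_set (($) (P *v w)) K) (L2_set (($) (P *v w)) (- K))"
        by (simp_all only: eq matrix_vector_mul_assoc)
      then show "y \<in> ?L" by blast
    qed
  qed
  show thesis
  proof (rule that[of "Q ** P"])
    show "orthogonal_matrix (Q ** P)"
      by (rule orthogonal_matrix_mul[OF Q P])
  qed (use img[of _ "\<lambda>s t. s \<le> _ \<and> t \<le> _"] img[of _ "\<lambda>s t. s = _ \<and> t \<le> _"] in
      \<open>simp_all add: cylinder_def lateral_boundary_def\<close>)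
qed

end

theory Submission
  imports Defs
begin

text \<open>
  If a cylinder meets the complement of \<open>U\<close>, it does so only in its wall, where the distance to the
  axis plane is \<open>b\<close>. A function that decreases with this distance and is convex in its radial
  direction, perturbed by a small convex function of the \<open>k\<close> remaining coordinates and cut off by a
  penalty outside the cylinder, attains its maximum over the complement near the wall; its Hessian
  there has \<open>k + 1\<close> positive directions, so condition G fails.

  Conversely, a test function violating G shows that near the contact point \<open>x0\<close> the complement lies
  in \<open>p \<bullet> h + c |h'|\<^sup>2 - M |h''|\<^sup>2 \<le> 0\<close>, where \<open>h'\<close> ranges over at least \<open>k + 1\<close> dimensions.
  If \<open>p \<noteq> 0\<close>, then \<open>k\<close> of these directions are orthogonal to \<open>p\<close>, and a thin cylinder with these
  directions touches the complement from the side of \<open>p\<close> exactly in \<open>x0\<close>. If \<open>p = 0\<close>, a small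
  translation of the form produces another contact point at which the gradient does not vanish.
\<close>

subsection \<open>Orthonormal families\<close>

text \<open>With eigenvalues in nondecreasing order, the one of index \<open>CARD('n) - k\<close> is
  positive exactly when more than \<open>k\<close> of them are. So both directions revolve around
  \<open>k + 1\<close> dimensions. The axis of a cylinder takes \<open>k\<close> of them; the extra
  one is the radial direction of the barrier, or the dimension lost in intersecting with the
  hyperplane orthogonal to the gradient.

  Condition G tests a maximum over all of \<Omega> - \<open>U\<close>, which need not be compact.
  The maximum is therefore taken over a compact piece, and the constants of the barrier are tuned so
  that it stays lower elsewhere. The penalty is the cube of a positive part because the test
  function must be C^2.

  In the converse a vanishing gradient is a real obstacle: the quadratic bound then singles out no
  side from which a cylinder could touch. Translation helps because the only critical point of a
  nondegenerate quadratic form is its centre, where the form is 0, whereas the new contact point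
  lies at a positive level.\<close>

definition orthonormal_family :: "('n::finite \<Rightarrow> real^'n) \<Rightarrow> bool" where
  "orthonormal_family u \<longleftrightarrow> (\<forall>i j. u i \<bullet> u j = (if i = j then 1 else 0))"

lemma orthonormal_family_column:
  fixes Q :: "real^'n^'n"
  assumes "orthogonal_matrix Q"
  shows "orthonormal_family (\<lambda>i. column i Q)"
  using assms
  by (auto simp: orthonormal_family_def orthogonal_matrix_orthonormal_columns norm_eq_1
      orthogonal_def)

lemma orthogonal_matrix_of_family:
  fixes u :: "'n \<Rightarrow> real^'n"
  assumes "orthonormal_family u"
  shows "orthogonal_matrix (\<chi> a b. u b $ a)"
proof -
  have "column i (\<chi> a b. u b $ a) = u i" for i
    by (simp add: column_def vec_eq_iff)
  then show ?thesis
    using assms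
    by (auto simp: orthonormal_family_def orthogonal_matrix_orthonormal_columns norm_eq_1
        orthogonal_def)
qed

lemma matrix_vector_mult_columns:
  fixes Q :: "real^'n^'n"
  shows "Q *v x = (\<Sum>i\<in>UNIV. x $ i *\<^sub>R column i Q)"
  by (simp add: matrix_vector_mult_def column_def vec_eq_iff mult.commute)

text \<open>The index type has as many elements as the space has dimensions, so an orthonormal
  family is automatically a basis: its matrix also satisfies
  \<open>Q ** transpose Q = mat 1\<close>, which is this expansion.\<close>

lemma orthonormal_expansion:
  assumes "orthonormal_family u"
  shows "(\<Sum>i\<in>UNIV. (u i \<bullet> x) *\<^sub>R u i) = x"
proof -
  define Q where "Q = (\<chi> a b. u b $ a)"
  have "Q ** transpose Q = mat 1"
    using orthogonal_matrix_of_family[OF assms] by (simp add: orthogonal_matrix_def Q_def)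
  then have "Q *v (transpose Q *v x) = x"
    by (simp only: matrix_vector_mul_assoc matrix_vector_mul_lid)
  moreover have "(transpose Q *v x) $ i = u i \<bullet> x" for i
    by (simp add: Q_def vector_matrix_mult_def inner_vec_def mult.commute)
  moreover have "column i Q = u i" for i
    by (simp add: Q_def column_def vec_eq_iff)
  ultimately show ?thesis
    by (simp only: matrix_vector_mult_columns)
qed

lemma orthonormal_inner:
  assumes "orthonormal_family u"
  shows "x \<bullet> y = (\<Sum>i\<in>UNIV. (u i \<bullet> x) * (u i \<bullet> y))"
proof -
  have "x \<bullet> y = (\<Sum>i\<in>UNIV. (u i \<bullet> x) *\<^sub>R u i) \<bullet> y"
    by (simp only: orthonormal_expansion[OF assms])
  then show ?thesis
    by (simp add: inner_sum_left)
qed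

lemma orthonormal_coord_sum:
  assumes "orthonormal_family u"
  shows "u i \<bullet> (\<Sum>j\<in>S. c j *\<^sub>R u j) = (if i \<in> S then c i else 0)"
proof -
  have "u i \<bullet> (\<Sum>j\<in>S. c j *\<^sub>R u j) = (\<Sum>j\<in>S. if i = j then c j else 0)"
    unfolding inner_sum_right
    by (rule sum.cong) (use assms in \<open>auto simp: orthonormal_family_def\<close>)
  then show ?thesis by simp
qed

lemma orthonormal_family_inj:
  assumes "orthonormal_family u"
  shows "inj u"
  by (rule injI) (use assms in \<open>metis orthonormal_family_def zero_neq_one\<close>)

lemma dim_span_orthonormal:
  assumes "orthonormal_family u"
  shows "dim (span (u ` S)) = card S"
proof -
  have "pairwise orthogonal (u ` S)"
    using assms by (auto simp: pairwise_def orthogonal_def orthonormal_family_def)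
  moreover have "0 \<notin> u ` S"
    using assms by (metis image_iff inner_zero_left orthonormal_family_def zero_neq_one)
  ultimately have "independent (u ` S)"
    by (rule pairwise_orthogonal_independent)
  then show ?thesis
    by (simp add: dim_eq_card_independent card_image
        inj_on_subset[OF orthonormal_family_inj[OF assms]])
qed

lemma span_orthonormal_coord:
  assumes "orthonormal_family u" "y \<in> span (u ` S)" "i \<notin> S"
  shows "u i \<bullet> y = 0"
proof -
  have "orthogonal (u i) y"
    by (rule orthogonal_to_span[OF assms(2)])
      (use assms in \<open>auto simp: orthogonal_def orthonormal_family_def\<close>)
  then show ?thesis by (simp add: orthogonal_def)
qed

text \<open>The vectors orthogonal to all \<open>u i\<close> with \<open>i\<close> in
  \<open>S\<close> form a space of codimension \<open>card S\<close>, which is too small to avoid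
  \<open>V\<close>.\<close>

lemma exists_nonzero_orthogonal_to_few:
  assumes u: "orthonormal_family u" and V: "subspace V" and card: "card S < dim V"
  obtains h where "h \<in> V" "h \<noteq> 0" "\<And>i. i \<in> S \<Longrightarrow> u i \<bullet> h = 0"
proof -
  let ?W = "span (u ` (- S))"
  have "dim (V \<inter> ?W) \<noteq> 0"
  proof -
    have "dim {x + y |x y. x \<in> V \<and> y \<in> ?W} + dim (V \<inter> ?W) = dim V + dim ?W"
      by (rule dim_sums_Int[OF V subspace_span])
    moreover have "dim {x + y |x y. x \<in> V \<and> y \<in> ?W} \<le> CARD('a)"
      using dim_subset_UNIV[of "{x + y |x y. x \<in> V \<and> y \<in> ?W}"] by simp
    moreover have "dim ?W = CARD('a) - card S"
      unfolding dim_span_orthonormal[OF u] by (simp add: Compl_eq_Diff_UNIV card_Diff_subset)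
    moreover have "card S \<le> CARD('a)"
      by (simp add: card_mono)
    ultimately show ?thesis using card by linarith
  qed
  then obtain h where "h \<in> V \<inter> ?W" "h \<noteq> 0"
    by (metis dim_eq_0 singletonI subset_iff)
  then show thesis
    using that span_orthonormal_coord[OF u] by (metis ComplD IntE)
qed

lemma orthonormal_basis_to_family:
  fixes B :: "(real^'n) set"
  assumes "pairwise orthogonal B" "\<And>x. x \<in> B \<Longrightarrow> norm x = 1" "card B = CARD('n)"
  obtains u :: "'n \<Rightarrow> real^'n" where "orthonormal_family u" "range u = B"
proof -
  have "finite B" using assms(3) by (simp add: card_ge_0_finite)
  then obtain u :: "'n \<Rightarrow> real^'n" where u: "bij_betw u UNIV B"
    using assms(3) by (metis finite finite_same_card_bij)
  have "orthonormal_family u"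
    unfolding orthonormal_family_def
  proof (intro allI)
    fix i j
    have "u i \<in> B" "u j \<in> B" "i \<noteq> j \<longrightarrow> u i \<noteq> u j"
      using u by (auto simp: bij_betw_def inj_def)
    then show "u i \<bullet> u j = (if i = j then 1 else 0)"
      using assms(1,2) by (auto simp: pairwise_def orthogonal_def norm_eq_1)
  qed
  then show thesis using that u by (auto simp: bij_betw_def)
qed

text \<open>Cylinders are described by index sets, so a subspace has to be turned into one:
  orthonormal bases of \<open>Y\<close> and of its orthogonal complement are joined, and
  \<open>K\<close> indexes the first.\<close>

lemma orthonormal_family_adapted:
  fixes Y :: "(real^'n) set"
  assumes "subspace Y"
  obtains u K where "orthonormal_family u" "card K = dim Y" "\<And>i. i \<in> K \<Longrightarrow> u i \<in> Y"
proof -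
  define Z where "Z = {z. \<forall>y\<in>Y. orthogonal y z}"
  have dimZ: "dim Z + dim Y = CARD('n)"
    using dim_subspace_orthogonal_to_vectors[OF assms subspace_UNIV] by (simp add: Z_def)
  obtain B where B: "B \<subseteq> Y" "pairwise orthogonal B" "\<And>x. x \<in> B \<Longrightarrow> norm x = 1"
    "card B = dim Y" "independent B"
    using orthonormal_basis_subspace[OF assms] by metis
  have "subspace Z" unfolding Z_def by (rule subspace_orthogonal_to_vectors)
  then obtain C where C: "C \<subseteq> Z" "pairwise orthogonal C" "\<And>x. x \<in> C \<Longrightarrow> norm x = 1"
    "card C = dim Z" "independent C"
    using orthonormal_basis_subspace[of Z] by metis
  have fin: "finite B" "finite C"
    using B C independent_imp_finite by blast+
  have cross: "x \<bullet> y = 0" if "x \<in> B" "y \<in> C" for x y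
    using that B(1) C(1) by (auto simp: Z_def orthogonal_def)
  have disj: "B \<inter> C = {}"
  proof (rule ccontr)
    assume "B \<inter> C \<noteq> {}"
    then obtain x where "x \<in> B" "x \<in> C" by blast
    then show False using cross[of x x] B(3)[of x] by simp
  qed
  have "pairwise orthogonal (B \<union> C)"
    using B(2) C(2) cross
    by (auto simp: pairwise_def orthogonal_def) (metis inner_commute)
  moreover have "card (B \<union> C) = CARD('n)"
    using card_Un_disjoint[OF fin disj] B(4) C(4) dimZ by simp
  moreover have "norm x = 1" if "x \<in> B \<union> C" for x
    using that B C by blast
  ultimately obtain u where u: "orthonormal_family u" "range u = B \<union> C"
    using orthonormal_basis_to_family[of "B \<union> C"] by metis
  show thesis
  proof (rule that[OF u(1)])
    have "card (u -` B) = card B"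
      by (rule card_vimage_inj[OF orthonormal_family_inj[OF u(1)]]) (use u in auto)
    then show "card (u -` B) = dim Y" using B by simp
  qed (use B in auto)
qed

subsection \<open>The spectral theorem and ordered eigenvalues\<close>

lemma symmetric_matrix_inner:
  fixes X :: "real^'n^'n"
  assumes "transpose X = X"
  shows "x \<bullet> (X *v y) = (X *v x) \<bullet> y"
  by (metis assms dot_lmul_matrix transpose_matrix_vector)

text \<open>At a maximizer \<open>v\<close> of the Rayleigh quotient on the unit sphere of
  \<open>S\<close>, the defect \<open>X *v v - c *\<^sub>R v\<close> lies in \<open>S\<close> and is
  orthogonal to \<open>v\<close>. Moving along it would raise the quotient at first order unless it
  vanishes.\<close>

lemma symmetric_eigenvector_in_subspace:
  fixes X :: "real^'n^'n"
  assumes sym: "transpose X = X" and S: "subspace S" "S \<noteq> {0}"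
    and inv: "\<And>x. x \<in> S \<Longrightarrow> X *v x \<in> S"
  obtains v c where "v \<in> S" "norm v = 1" "X *v v = c *\<^sub>R v"
proof -
  let ?K = "S \<inter> sphere 0 1"
  obtain w where w: "w \<in> S" "w \<noteq> 0"
    using S subspace_0 by blast
  then have "(1 / norm w) *\<^sub>R w \<in> ?K"
    using S by (simp add: subspace_scale)
  then have ne: "?K \<noteq> {}" by blast
  have comp: "compact ?K"
    by (simp add: closed_Int_compact closed_subspace S)
  have cont: "continuous_on ?K (\<lambda>x. x \<bullet> (X *v x))"
    by (intro continuous_intros linear_continuous_on matrix_vector_mul_bounded_linear)
  obtain v where v: "v \<in> ?K" and max: "\<forall>x\<in>?K. x \<bullet> (X *v x) \<le> v \<bullet> (X *v v)"
    using continuous_attains_sup[OF comp ne cont] by blast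
  define c where "c = v \<bullet> (X *v v)"
  define g where "g = X *v v - c *\<^sub>R v"
  have vv: "v \<bullet> v = 1" using v by (simp add: norm_eq_1)
  have gS: "g \<in> S" using v inv S by (simp add: g_def subspace_diff subspace_scale)
  have vg: "v \<bullet> g = 0" by (simp add: g_def inner_diff_right vv c_def)
  have vXg: "v \<bullet> (X *v g) = g \<bullet> g" "g \<bullet> (X *v v) = g \<bullet> g"
  proof -
    have "X *v v = g + c *\<^sub>R v" by (simp add: g_def)
    then show "v \<bullet> (X *v g) = g \<bullet> g" "g \<bullet> (X *v v) = g \<bullet> g"
      using vg by (simp_all add: symmetric_matrix_inner[OF sym] inner_left_distrib
          inner_right_distrib inner_commute)
  qed
  have quad: "x \<bullet> (X *v x) \<le> c * (x \<bullet> x)" if "x \<in> S" for x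
  proof (cases "x = 0")
    case False
    define y where "y = (1 / norm x) *\<^sub>R x"
    have "y \<in> ?K" using False that S by (simp add: y_def subspace_scale)
    then have "y \<bullet> (X *v y) \<le> c" using max unfolding c_def by blast
    moreover have "y \<bullet> (X *v y) = (x \<bullet> (X *v x)) / (x \<bullet> x)"
      by (simp add: y_def matrix_vector_mult_scaleR power2_norm_eq_inner[symmetric] power2_eq_square)
    ultimately show ?thesis using False by (simp add: divide_le_eq)
  qed simp
  have ineq: "2 * t * (g \<bullet> g) \<le> t\<^sup>2 * (c * (g \<bullet> g) - g \<bullet> (X *v g))" for t
  proof -
    have "v + t *\<^sub>R g \<in> S" using v gS S by (simp add: subspace_add subspace_scale)
    from quad[OF this] show ?thesis
      by (simp add: matrix_vector_right_distrib matrix_vector_mult_scaleR inner_left_distrib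
          inner_right_distrib vXg vg inner_commute[of g v] vv c_def[symmetric] power2_eq_square
          algebra_simps)
  qed
  have "g \<bullet> g = 0"
  proof (rule ccontr)
    assume "g \<bullet> g \<noteq> 0"
    then have pos: "g \<bullet> g > 0" by (metis inner_ge_zero less_le)
    define m where "m = \<bar>c * (g \<bullet> g) - g \<bullet> (X *v g)\<bar> + 1"
    \<comment> \<open>With this \<open>t\<close> the upper bound t^2 m equals t times the squared
      length of \<open>g\<close>, half of the left side of \<open>ineq\<close>.\<close>
    define t where "t = (g \<bullet> g) / m"
    have m: "m > 0" "c * (g \<bullet> g) - g \<bullet> (X *v g) \<le> m" by (auto simp: m_def)
    have t: "t > 0" using pos m by (simp add: t_def)
    have "2 * t * (g \<bullet> g) \<le> t\<^sup>2 * m"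
      using ineq[of t] mult_left_mono[OF m(2), of "t\<^sup>2"] by simp
    also have "\<dots> = t * (g \<bullet> g)" using m by (simp add: t_def power2_eq_square)
    finally show False using t pos by (simp add: mult_pos_pos)
  qed
  then have "X *v v = c *\<^sub>R v" by (simp add: g_def)
  then show thesis using that v by auto
qed

text \<open>An orthonormal set of eigenvectors of maximal size is complete: otherwise its orthogonal
  complement, which is invariant by symmetry, contains one more eigenvector.\<close>

theorem symmetric_matrix_spectral:
  fixes X :: "real^'n^'n"
  assumes sym: "transpose X = X"
  obtains u d where "orthonormal_family u" "\<And>i. X *v u i = d i *\<^sub>R u i"
proof -
  define P where "P B \<longleftrightarrow> pairwise orthogonal B \<and> (\<forall>x\<in>B. norm x = 1 \<and> (\<exists>c. X *v x = c *\<^sub>R x))"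
    for B :: "(real^'n) set"
  have indep: "independent B" if "P B" for B
    by (rule pairwise_orthogonal_independent) (use that in \<open>auto simp: P_def\<close>)
  have bound: "card B \<le> CARD('n)" if "P B" for B
    using independent_card_le[OF indep[OF that]] by simp
  have "P {}" by (simp add: P_def)
  then obtain B where PB: "P B" and maxB: "\<And>B'. P B' \<Longrightarrow> card B' \<le> card B"
    using ex_has_greatest_nat[of P "{}" card "CARD('n) + 1"] bound
    by (metis less_Suc_eq_le Suc_eq_plus1)
  have "card B = CARD('n)"
  proof (rule ccontr)
    assume ne: "card B \<noteq> CARD('n)"
    let ?S = "{y. \<forall>x\<in>B. orthogonal x y}"
    have S: "subspace ?S" by (rule subspace_orthogonal_to_vectors)
    have "\<exists>y. y \<in> ?S \<and> y \<noteq> 0"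
    proof -
      have "dim (span B) < DIM(real^'n)"
        using ne bound[OF PB] dim_eq_card_independent[OF indep[OF PB]] by simp
      then have "span B \<subset> UNIV" by (metis dim_UNIV less_irrefl psubsetI subset_UNIV)
      then obtain y where "y \<noteq> 0" "\<And>x. x \<in> span B \<Longrightarrow> orthogonal y x"
        by (metis orthogonal_to_subspace_exists_gen psubset_imp_subset span_UNIV)
      then show ?thesis using orthogonal_commute span_base by blast
    qed
    then have "?S \<noteq> {0}" by blast
    moreover have "X *v y \<in> ?S" if "y \<in> ?S" for y
    proof -
      have "x \<bullet> (X *v y) = 0" if "x \<in> B" for x
      proof -
        obtain c where "X *v x = c *\<^sub>R x" using PB \<open>x \<in> B\<close> by (auto simp: P_def)
        then show ?thesis
          using \<open>y \<in> ?S\<close> \<open>x \<in> B\<close> by (simp add: symmetric_matrix_inner[OF sym] orthogonal_def)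
      qed
      then show ?thesis by (simp add: orthogonal_def)
    qed
    ultimately obtain v c where v: "v \<in> ?S" "norm v = 1" "X *v v = c *\<^sub>R v"
      using symmetric_eigenvector_in_subspace[OF sym S] by blast
    have "P (insert v B)"
      using PB v by (auto simp: P_def pairwise_insert orthogonal_commute)
    moreover have "v \<notin> B" using v by (auto simp: orthogonal_def norm_eq_1)
    moreover have "finite B" using indep[OF PB] independent_imp_finite by blast
    ultimately show False using maxB by fastforce
  qed
  then obtain u where u: "orthonormal_family u" "range u = B"
    using orthonormal_basis_to_family PB by (metis P_def)
  have "\<forall>i. \<exists>c. X *v u i = c *\<^sub>R u i" using u(2) PB by (auto simp: P_def)
  then obtain d where "\<And>i. X *v u i = d i *\<^sub>R u i" by metis
  then show thesis using that u by blast
qed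

section \<open>Characteristic polynomials and the number of positive eigenvalues\<close>

lemma map_matrix_const_mult:
  fixes A B :: "real^'n^'n"
  shows "map_matrix (\<lambda>c. [:c:]) (A ** B) =
    (map_matrix (\<lambda>c. [:c:]) A ** map_matrix (\<lambda>c. [:c:]) B :: real poly^'n^'n)"
proof -
  have "[:sum f S:] = (\<Sum>i\<in>S. [:f i:])" for f :: "'n \<Rightarrow> real" and S
    by (rule poly_eqI) (simp add: coeff_sum coeff_pCons split: nat.split)
  then show ?thesis
    by (simp add: vec_eq_iff matrix_matrix_mult_def mult.commute)
qed

text \<open>The diagonalization takes place over the polynomial ring: the eigenvector matrix is
  embedded as constants, the scalar matrix of the indeterminate commutes with it, and the two outer
  determinants cancel.\<close>

lemma charpoly_orthonormal_eigenvectors: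
  fixes X :: "real^'n^'n"
  assumes u: "orthonormal_family u" and d: "\<And>i. X *v u i = d i *\<^sub>R u i"
  shows "charpoly X = (\<Prod>i\<in>UNIV. [:- d i, 1:])"
proof -
  let ?C = "map_matrix (\<lambda>c. [:c:]) :: real^'n^'n \<Rightarrow> real poly^'n^'n"
  define Q :: "real^'n^'n" where "Q = (\<chi> a b. u b $ a)"
  have Q: "transpose Q ** Q = mat 1"
    using orthogonal_matrix_of_family[OF u] by (simp add: orthogonal_matrix_def Q_def)
  have "(transpose Q ** (X ** Q)) $ i $ j = u i \<bullet> (X *v u j)" for i j
    by (simp add: Q_def matrix_matrix_mult_def transpose_def inner_vec_def matrix_vector_mult_def)
  then have D: "(transpose Q ** X ** Q) $ i $ j = (if i = j then d i else 0)" for i j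
    using u d by (simp add: orthonormal_family_def matrix_mul_assoc)
  have C1: "?C (mat 1) = mat 1"
    by (simp add: vec_eq_iff mat_def one_pCons)
  have det1: "det (?C (transpose Q)) * det (?C Q) = 1"
    by (simp add: det_mul[symmetric] map_matrix_const_mult[symmetric] Q C1)
  let ?x = "mat [:0, 1:] :: real poly^'n^'n"
  have comm: "A ** ?x = ?x ** A" for A :: "real poly^'n^'n"
    by (simp add: vec_eq_iff matrix_matrix_mult_def mat_def if_distrib if_distribR cong: if_cong)
  have ldiff: "A ** (B - C) = A ** B - A ** C" and rdiff: "(B - C) ** A = B ** A - C ** A"
    for A B C :: "real poly^'n^'n"
    by (simp_all add: vec_eq_iff matrix_matrix_mult_def sum_subtractf algebra_simps)
  have "?C (transpose Q) ** (?x - ?C X) ** ?C Q =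
      ?x ** (?C (transpose Q) ** ?C Q) - ?C (transpose Q) ** ?C X ** ?C Q"
    by (simp only: ldiff rdiff comm matrix_mul_assoc)
  also have "\<dots> = ?x ** ?C (transpose Q ** Q) - ?C (transpose Q ** X ** Q)"
    by (simp only: map_matrix_const_mult)
  also have "\<dots> = ?x - ?C (transpose Q ** X ** Q)"
    by (simp add: Q C1)
  finally have "det (?C (transpose Q) ** (?x - ?C X) ** ?C Q) = det (?x - ?C (transpose Q ** X ** Q))"
    by simp
  also have "\<dots> = (\<Prod>i\<in>UNIV. [:- d i, 1:])"
    by (subst det_diagonal) (auto simp: D mat_def)
  also have "det (?C (transpose Q) ** (?x - ?C X) ** ?C Q) = det (?x - ?C X)"
    using det1 by (simp add: det_mul mult.commute mult.left_commute)
  finally show ?thesis by (simp add: charpoly_def)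
qed

text \<open>The positive entries of a sorted list form a final segment, so only its length
  matters.\<close>

lemma sorted_nth_pos_iff:
  fixes xs :: "real list"
  assumes "sorted xs" "j < length xs"
  shows "xs ! j > 0 \<longleftrightarrow> length xs - j \<le> length (filter (\<lambda>x. 0 < x) xs)"
proof
  assume pos: "xs ! j > 0"
  have "{j..<length xs} \<subseteq> {i. i < length xs \<and> 0 < xs ! i}"
    using pos sorted_nth_mono[OF assms(1), of j] by fastforce
  then have "card {j..<length xs} \<le> card {i. i < length xs \<and> 0 < xs ! i}"
    by (intro card_mono) auto
  then show "length xs - j \<le> length (filter (\<lambda>x. 0 < x) xs)"
    by (simp add: length_filter_conv_card)
next
  assume len: "length xs - j \<le> length (filter (\<lambda>x. 0 < x) xs)"
  show "xs ! j > 0"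
  proof (rule ccontr)
    assume neg: "\<not> xs ! j > 0"
    have "i \<in> {Suc j..<length xs}" if "i < length xs" "0 < xs ! i" for i
      using that neg sorted_nth_mono[OF assms(1), of i j] assms(2) by (cases "i \<le> j") auto
    then have "{i. i < length xs \<and> 0 < xs ! i} \<subseteq> {Suc j..<length xs}"
      by blast
    then have "card {i. i < length xs \<and> 0 < xs ! i} \<le> card {Suc j..<length xs}"
      by (intro card_mono) auto
    then show False using len assms(2) by (simp add: length_filter_conv_card)
  qed
qed

lemma eigval_pos_iff:
  fixes X :: "real^'n^'n"
  assumes u: "orthonormal_family u" and d: "\<And>i. X *v u i = d i *\<^sub>R u i" and k: "k < CARD('n)"
  shows "eigval (CARD('n) - k) X > 0 \<longleftrightarrow> k < card {i. d i > 0}"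
proof -
  have "proots (charpoly X) = (\<Sum>i\<in>UNIV. {#d i#})"
    by (simp add: charpoly_orthonormal_eigenvectors[OF u d] proots_prod)
  also have "\<dots> = image_mset d (mset_set UNIV)"
    by (simp add: sum_unfold_sum_mset)
  finally have roots: "proots (charpoly X) = image_mset d (mset_set UNIV)" .
  let ?xs = "eigenvalues X"
  have mset: "mset ?xs = image_mset d (mset_set UNIV)"
    by (simp add: eigenvalues_def roots)
  have len: "length ?xs = CARD('n)"
    by (metis mset size_image_mset size_mset size_mset_set)
  have "length (filter (\<lambda>x. 0 < x) ?xs) = size (filter_mset (\<lambda>x. 0 < x) (mset ?xs))"
    by (metis mset_filter size_mset)
  also have "\<dots> = card {i. d i > 0}"
    by (simp add: mset filter_mset_image_mset)
  finally have "length (filter (\<lambda>x. 0 < x) ?xs) = card {i. d i > 0}" .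
  \<comment> \<open>In the zero-based list the entry has position \<open>CARD('n) - k - 1\<close>,
    and \<open>k + 1\<close> entries start there.\<close>
  then show ?thesis
    using sorted_nth_pos_iff[of ?xs "CARD('n) - k - 1"] len k
    by (auto simp: eigval_def eigenvalues_def)
qed

text \<open>One half of the Courant-Fischer principle: with at most \<open>k\<close> positive
  eigenvalues, \<open>V\<close> would contain a nonzero vector orthogonal to all their eigenvectors,
  and the form is nonpositive there.\<close>

lemma eigval_pos_if_positive_on_subspace:
  fixes X :: "real^'n^'n"
  assumes sym: "transpose X = X" and V: "subspace V" "k < dim V"
    and pos: "\<And>h. h \<in> V \<Longrightarrow> h \<noteq> 0 \<Longrightarrow> h \<bullet> (X *v h) > 0"
  shows "eigval (CARD('n) - k) X > 0"
proof -
  obtain u d where u: "orthonormal_family u" and d: "\<And>i. X *v u i = d i *\<^sub>R u i"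
    using symmetric_matrix_spectral[OF sym] by metis
  have "dim V \<le> CARD('n)"
    using dim_subset_UNIV[of V] by simp
  then have k: "k < CARD('n)" using V by simp
  have "k < card {i. d i > 0}"
  proof (rule ccontr)
    assume "\<not> ?thesis"
    then have "card {i. d i > 0} < dim V" using V by simp
    then obtain h where h: "h \<in> V" "h \<noteq> 0" "\<And>i. d i > 0 \<Longrightarrow> u i \<bullet> h = 0"
      using exists_nonzero_orthogonal_to_few[OF u V(1)] by (metis mem_Collect_eq)
    have "h \<bullet> (X *v h) = (\<Sum>i\<in>UNIV. (u i \<bullet> h) * (u i \<bullet> (X *v h)))"
      by (rule orthonormal_inner[OF u])
    also have "\<dots> = (\<Sum>i\<in>UNIV. d i * (u i \<bullet> h)\<^sup>2)"
      by (simp add: symmetric_matrix_inner[OF sym] d power2_eq_square algebra_simps)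
    also have "\<dots> \<le> 0"
    proof (rule sum_nonpos)
      fix i show "d i * (u i \<bullet> h)\<^sup>2 \<le> 0"
        using h(3)[of i] by (cases "d i > 0") (auto simp: mult_nonpos_nonneg)
    qed
    finally show False using pos h by fastforce
  qed
  then show ?thesis by (simp add: eigval_pos_iff[OF u d k])
qed

subsection \<open>Second derivatives\<close>

lemma dist_self_add: "dist x (x + v) = norm v" for x v :: "'a::real_normed_vector"
  by (simp add: dist_norm)

lemma remainder_bound:
  fixes G :: "real^'n \<Rightarrow> real^'n"
  assumes "(G has_derivative A) (at x)" "e > 0"
  obtains d where "d > 0" "\<And>h. norm h < d \<Longrightarrow> norm (G (x + h) - G x - A h) \<le> e * norm h"
proof -
  obtain d where d: "d > 0" "\<And>y. norm (y - x) < d \<Longrightarrow> norm (G y - G x - A (y - x)) \<le> e * norm (y - x)"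
    using assms unfolding has_derivative_at_alt by blast
  show thesis
    by (rule that[OF d(1)]) (use d(2)[of "x + _"] in simp)
qed

text \<open>The second difference is symmetric in \<open>a\<close> and \<open>b\<close>, which later
  forces the second derivative to be symmetric. The mean value theorem in direction \<open>a\<close>
  turns it into a difference of gradients at two points within \<open>t * m\<close> of
  \<open>x\<close>, so differentiability of \<open>G\<close> at \<open>x\<close> alone controls the
  error.\<close>

lemma second_difference_bound:
  fixes f :: "real^'n \<Rightarrow> real"
  assumes r: "r > 0" and f: "\<And>y. y \<in> ball x r \<Longrightarrow> (f has_derivative (\<lambda>h. G y \<bullet> h)) (at y)"
    and G: "(G has_derivative A) (at x)" and e: "e > 0"
  obtains d where "d > 0"
    "\<And>t. 0 < t \<Longrightarrow> t < d \<Longrightarrow>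
      \<bar>f (x + t *\<^sub>R a + t *\<^sub>R b) - f (x + t *\<^sub>R a) - f (x + t *\<^sub>R b) + f x - t\<^sup>2 * (A b \<bullet> a)\<bar> \<le> e * t\<^sup>2"
proof -
  define m where "m = norm a + norm b + 1"
  have m: "m > 0" "norm a \<le> m" "norm a + norm b \<le> m"
    by (auto simp: m_def add_nonneg_pos)
  \<comment> \<open>Two gradient remainders of size \<open>e' * (t * m)\<close>, paired with a
    vector of length at most \<open>m\<close>, add up to \<open>t * e\<close>.\<close>
  define e' where "e' = e / (2 * m * m)"
  have e': "e' > 0" "e' * (2 * m * m) = e" using e m by (auto simp: e'_def)
  obtain d0 where d0: "d0 > 0" "\<And>h. norm h < d0 \<Longrightarrow> norm (G (x + h) - G x - A h) \<le> e' * norm h"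
    using remainder_bound[OF G e'(1)] by metis
  define d where "d = min d0 r / m"
  have d: "d > 0" using d0 r m by (simp add: d_def)
  have A: "linear A" using G by (rule has_derivative_linear)
  show thesis
  proof (rule that[OF d])
    fix t :: real assume t: "0 < t" "t < d"
    have tm: "t * m < d0" "t * m < r"
      using t m by (auto simp: d_def pos_less_divide_eq)
    have small: "norm (s *\<^sub>R a + c *\<^sub>R b) \<le> t * m" if "0 \<le> s" "s \<le> t" "0 \<le> c" "c \<le> t" for s c
    proof -
      have "norm (s *\<^sub>R a + c *\<^sub>R b) \<le> s * norm a + c * norm b"
        using that by (metis abs_of_nonneg norm_scaleR norm_triangle_ineq)
      also have "\<dots> \<le> t * norm a + t * norm b"
        using that by (intro add_mono mult_right_mono) auto
      also have "\<dots> = t * (norm a + norm b)" by (simp add: algebra_simps)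
      also have "\<dots> \<le> t * m" using m t by (intro mult_left_mono) auto
      finally show ?thesis .
    qed
    \<comment> \<open>The summand \<open>0 *\<^sub>R b\<close> gives both terms one shape, so that a
      single derivative formula serves them with coefficients \<open>t\<close> and 0.\<close>
    define g where "g s = f (x + (s *\<^sub>R a + t *\<^sub>R b)) - f (x + (s *\<^sub>R a + 0 *\<^sub>R b))" for s
    have der: "(g has_real_derivative
        (G (x + (s *\<^sub>R a + t *\<^sub>R b)) \<bullet> a - G (x + (s *\<^sub>R a + 0 *\<^sub>R b)) \<bullet> a)) (at s)"
      if "0 \<le> s" "s \<le> t" for s
    proof -
      have *: "((\<lambda>s. f (x + (s *\<^sub>R a + c *\<^sub>R b))) has_derivative
          (\<lambda>h. G (x + (s *\<^sub>R a + c *\<^sub>R b)) \<bullet> (h *\<^sub>R a))) (at s)" if "0 \<le> c" "c \<le> t" for c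
      proof (rule has_derivative_compose[where f = "\<lambda>s. x + (s *\<^sub>R a + c *\<^sub>R b)" and g = f])
        show "((\<lambda>s. x + (s *\<^sub>R a + c *\<^sub>R b)) has_derivative (\<lambda>h. h *\<^sub>R a)) (at s)"
          by (auto intro!: derivative_eq_intros)
        show "(f has_derivative (\<bullet>) (G (x + (s *\<^sub>R a + c *\<^sub>R b)))) (at (x + (s *\<^sub>R a + c *\<^sub>R b)))"
          by (rule f) (use small[OF \<open>0 \<le> s\<close> \<open>s \<le> t\<close> that] tm in \<open>simp add: dist_self_add\<close>)
      qed
      show ?thesis
        unfolding g_def has_field_derivative_def
        by (rule has_derivative_eq_rhs, rule has_derivative_diff[OF *[of t] *[of 0]])
          (use t in \<open>auto simp: algebra_simps\<close>)
    qed
    obtain s where s: "0 < s" "s < t"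
      "g t - g 0 = (t - 0) * (G (x + (s *\<^sub>R a + t *\<^sub>R b)) \<bullet> a - G (x + (s *\<^sub>R a + 0 *\<^sub>R b)) \<bullet> a)"
      using MVT2[OF t(1) der] by metis
    define R where "R h = G (x + h) - G x - A h" for h
    define h1 h2 where "h1 = s *\<^sub>R a + t *\<^sub>R b" and "h2 = s *\<^sub>R a + 0 *\<^sub>R b"
    have Rb: "norm (R h1) \<le> e' * (t * m)" "norm (R h2) \<le> e' * (t * m)"
    proof -
      have n: "norm h1 \<le> t * m" "norm h2 \<le> t * m"
        unfolding h1_def h2_def by (rule small; use s in simp)+
      have "norm (R h) \<le> e' * (t * m)" if "norm h \<le> t * m" for h
      proof -
        have "norm (R h) \<le> e' * norm h"
          unfolding R_def by (rule d0(2)) (use that tm in linarith)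
        also have "\<dots> \<le> e' * (t * m)"
          using that e' by (intro mult_left_mono) auto
        finally show ?thesis .
      qed
      then show "norm (R h1) \<le> e' * (t * m)" "norm (R h2) \<le> e' * (t * m)"
        using n by blast+
    qed
    have "A h1 - A h2 = t *\<^sub>R A b"
      using linear_diff[OF A, of h1 h2] linear_cmul[OF A, of t b] by (simp add: h1_def h2_def)
    then have dG: "G (x + h1) - G (x + h2) = t *\<^sub>R A b + (R h1 - R h2)"
      by (simp add: R_def algebra_simps)
    have "g t - g 0 = t * ((G (x + h1) - G (x + h2)) \<bullet> a)"
      using s(3) by (simp add: h1_def h2_def inner_diff_left)
    also have "\<dots> = t\<^sup>2 * (A b \<bullet> a) + t * ((R h1 - R h2) \<bullet> a)"
      unfolding dG by (simp add: inner_add_left power2_eq_square distrib_left mult.assoc)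
    finally have eq: "g t - g 0 - t\<^sup>2 * (A b \<bullet> a) = t * ((R h1 - R h2) \<bullet> a)"
      by simp
    have "\<bar>(R h1 - R h2) \<bullet> a\<bar> \<le> norm (R h1 - R h2) * norm a"
      by (rule Cauchy_Schwarz_ineq2)
    also have "\<dots> \<le> (e' * (t * m) + e' * (t * m)) * m"
    proof (rule mult_mono)
      show "norm (R h1 - R h2) \<le> e' * (t * m) + e' * (t * m)"
        using Rb norm_triangle_ineq4[of "R h1" "R h2"] by linarith
    qed (use m t e' in auto)
    also have "\<dots> = t * (e' * (2 * m * m))" by (simp add: algebra_simps)
    also have "\<dots> = t * e" by (simp only: e')
    finally have "\<bar>t * ((R h1 - R h2) \<bullet> a)\<bar> \<le> t * (t * e)"
      using t by (simp add: abs_mult)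
    then have "\<bar>g t - g 0 - t\<^sup>2 * (A b \<bullet> a)\<bar> \<le> e * t\<^sup>2"
      unfolding eq by (simp add: power2_eq_square algebra_simps)
    then show "\<bar>f (x + t *\<^sub>R a + t *\<^sub>R b) - f (x + t *\<^sub>R a) - f (x + t *\<^sub>R b) + f x
        - t\<^sup>2 * (A b \<bullet> a)\<bar> \<le> e * t\<^sup>2"
      by (simp add: g_def add.assoc algebra_simps)
  qed
qed

theorem second_derivative_symmetric:
  fixes f :: "real^'n \<Rightarrow> real"
  assumes r: "r > 0" and f: "\<And>y. y \<in> ball x r \<Longrightarrow> (f has_derivative (\<lambda>h. G y \<bullet> h)) (at y)"
    and G: "(G has_derivative A) (at x)"
  shows "A b \<bullet> a = A a \<bullet> b"
proof -
  have "\<bar>A b \<bullet> a - A a \<bullet> b\<bar> \<le> e" if "e > 0" for e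
  proof -
    have e: "e / 2 > 0" using that by simp
    obtain d1 where d1: "d1 > 0" "\<And>t. 0 < t \<Longrightarrow> t < d1 \<Longrightarrow>
        \<bar>f (x + t *\<^sub>R a + t *\<^sub>R b) - f (x + t *\<^sub>R a) - f (x + t *\<^sub>R b) + f x - t\<^sup>2 * (A b \<bullet> a)\<bar>
          \<le> e / 2 * t\<^sup>2"
      using second_difference_bound[OF r f G e, of a b] by blast
    obtain d2 where d2: "d2 > 0" "\<And>t. 0 < t \<Longrightarrow> t < d2 \<Longrightarrow>
        \<bar>f (x + t *\<^sub>R b + t *\<^sub>R a) - f (x + t *\<^sub>R b) - f (x + t *\<^sub>R a) + f x - t\<^sup>2 * (A a \<bullet> b)\<bar>
          \<le> e / 2 * t\<^sup>2"
      using second_difference_bound[OF r f G e, of b a] by blast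
    define t where "t = min d1 d2 / 2"
    have t: "0 < t" "t < d1" "t < d2" using d1 d2 by (auto simp: t_def)
    have "x + t *\<^sub>R b + t *\<^sub>R a = x + t *\<^sub>R a + t *\<^sub>R b" by (simp add: algebra_simps)
    then have "\<bar>t\<^sup>2 * (A b \<bullet> a) - t\<^sup>2 * (A a \<bullet> b)\<bar> \<le> e / 2 * t\<^sup>2 + e / 2 * t\<^sup>2"
      using d1(2)[OF t(1,2)] d2(2)[OF t(1,3)] by (smt (verit))
    then have "\<bar>t\<^sup>2 * (A b \<bullet> a - A a \<bullet> b)\<bar> \<le> t\<^sup>2 * e"
      by (simp add: right_diff_distrib mult.commute)
    then have "t\<^sup>2 * \<bar>A b \<bullet> a - A a \<bullet> b\<bar> \<le> t\<^sup>2 * e"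
      by (simp only: abs_mult abs_power2)
    then show ?thesis using t by simp
  qed
  then show ?thesis
    using field_le_epsilon[of "\<bar>A b \<bullet> a - A a \<bullet> b\<bar>" 0] by simp
qed

text \<open>Along the segment, subtracting the Taylor polynomial leaves a function whose derivative
  is the first-order remainder of \<open>G\<close> paired with \<open>h\<close>; the mean value
  theorem then yields order two.\<close>

lemma second_order_taylor:
  fixes f :: "real^'n \<Rightarrow> real"
  assumes r: "r > 0" and f: "\<And>y. y \<in> ball x r \<Longrightarrow> (f has_derivative (\<lambda>h. G y \<bullet> h)) (at y)"
    and G: "(G has_derivative A) (at x)" and e: "e > 0"
  obtains d where "d > 0" "d \<le> r"
    "\<And>h. norm h < d \<Longrightarrow> \<bar>f (x + h) - f x - G x \<bullet> h - (A h \<bullet> h) / 2\<bar> \<le> e * (h \<bullet> h)"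
proof -
  obtain d0 where d0: "d0 > 0" "\<And>h. norm h < d0 \<Longrightarrow> norm (G (x + h) - G x - A h) \<le> e * norm h"
    using remainder_bound[OF G e] by metis
  have A: "linear A" using G by (rule has_derivative_linear)
  show thesis
  proof (rule that[of "min d0 r"])
    fix h :: "real^'n" assume h: "norm h < min d0 r"
    define g where "g t = f (x + t *\<^sub>R h) - t * (G x \<bullet> h) - t\<^sup>2 * ((A h \<bullet> h) / 2)" for t
    have der: "(g has_real_derivative (G (x + t *\<^sub>R h) \<bullet> h - G x \<bullet> h - t * (A h \<bullet> h))) (at t)"
      if "0 \<le> t" "t \<le> 1" for t
    proof -
      have th: "norm (t *\<^sub>R h) < r"
        using h that by (simp add: mult_left_le_one_le order_le_less_trans[of _ "norm h"])
      have "((\<lambda>t. f (x + t *\<^sub>R h)) has_derivative (\<lambda>c. G (x + t *\<^sub>R h) \<bullet> (c *\<^sub>R h))) (at t)"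
      proof (rule has_derivative_compose[where f = "\<lambda>t. x + t *\<^sub>R h" and g = f])
        show "((\<lambda>t. x + t *\<^sub>R h) has_derivative (\<lambda>c. c *\<^sub>R h)) (at t)"
          by (auto intro!: derivative_eq_intros)
        show "(f has_derivative (\<bullet>) (G (x + t *\<^sub>R h))) (at (x + t *\<^sub>R h))"
          by (rule f) (use th in \<open>simp add: dist_self_add\<close>)
      qed
      then have "((\<lambda>t. f (x + t *\<^sub>R h)) has_real_derivative (G (x + t *\<^sub>R h) \<bullet> h)) (at t)"
        by (simp add: has_field_derivative_def mult.commute[of _ "_ \<bullet> _"] mult_commute_abs)
      then show ?thesis
        unfolding g_def by (auto intro!: derivative_eq_intros)
    qed
    obtain t where t: "0 < t" "t < 1"
      "g 1 - g 0 = (1 - 0) * (G (x + t *\<^sub>R h) \<bullet> h - G x \<bullet> h - t * (A h \<bullet> h))"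
      using MVT2[OF zero_less_one der] by metis
    define R where "R = G (x + t *\<^sub>R h) - G x - A (t *\<^sub>R h)"
    have th: "norm (t *\<^sub>R h) \<le> norm h" using t by (simp add: mult_left_le_one_le)
    have "norm R \<le> e * norm (t *\<^sub>R h)"
      unfolding R_def by (rule d0(2)) (use th h in linarith)
    also have "\<dots> \<le> e * norm h" using th e by (intro mult_left_mono) auto
    finally have R: "norm R \<le> e * norm h" .
    have "g 1 - g 0 = R \<bullet> h"
      using t(3) linear_cmul[OF A, of t h] by (simp add: R_def inner_diff_left)
    then have "\<bar>g 1 - g 0\<bar> \<le> norm R * norm h"
      using Cauchy_Schwarz_ineq2 by metis
    also have "\<dots> \<le> e * norm h * norm h" using R by (rule mult_right_mono) simp
    also have "\<dots> = e * (h \<bullet> h)" by (simp add: power2_norm_eq_inner[symmetric] power2_eq_square)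
    finally show "\<bar>f (x + h) - f x - G x \<bullet> h - (A h \<bullet> h) / 2\<bar> \<le> e * (h \<bullet> h)"
      by (simp add: g_def algebra_simps)
  qed (use d0 r in auto)
qed

lemma has_derivative_partials:
  fixes f :: "real^'n \<Rightarrow> real"
  assumes "f differentiable (at x)"
  shows "(f has_derivative (\<lambda>h. (\<chi> i. partial i f x) \<bullet> h)) (at x)"
proof -
  let ?D = "frechet_derivative f (at x)"
  have D: "(f has_derivative ?D) (at x)"
    using assms by (simp add: frechet_derivative_works)
  then have lin: "linear ?D" by (rule has_derivative_linear)
  have "?D h = (\<chi> i. partial i f x) \<bullet> h" for h
  proof -
    have "h = (\<Sum>i\<in>UNIV. h $ i *\<^sub>R axis i 1)"
      using basis_expansion[of h] by (simp add: scalar_mult_eq_scaleR)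
    then have "?D h = ?D (\<Sum>i\<in>UNIV. h $ i *\<^sub>R axis i 1)" by simp
    also have "\<dots> = (\<Sum>i\<in>UNIV. h $ i * partial i f x)"
      by (simp add: linear_sum[OF lin] linear_cmul[OF lin] partial_def)
    finally show ?thesis by (simp add: inner_vec_def mult.commute)
  qed
  then have "?D = (\<lambda>h. (\<chi> i. partial i f x) \<bullet> h)" by blast
  then show ?thesis using D by simp
qed

lemma C2_on_taylor:
  fixes f :: "real^'n \<Rightarrow> real"
  assumes C2: "C2_on \<Omega> f" and \<Omega>: "open \<Omega>" "x \<in> \<Omega>"
  shows "transpose (hessian f x) = hessian f x"
    and "e > 0 \<Longrightarrow> \<exists>d>0. ball x d \<subseteq> \<Omega> \<and> (\<forall>h. norm h < d \<longrightarrow>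
      \<bar>f (x + h) - f x - (\<chi> i. partial i f x) \<bullet> h - h \<bullet> (hessian f x *v h) / 2\<bar> \<le> e * (h \<bullet> h))"
proof -
  define G where "G y = (\<chi> i. partial i f y)" for y
  obtain r where r: "r > 0" "ball x r \<subseteq> \<Omega>"
    using \<Omega> open_contains_ball by blast
  have f: "(f has_derivative (\<lambda>h. G y \<bullet> h)) (at y)" if "y \<in> ball x r" for y
    unfolding G_def
    using C2 r that \<Omega> by (intro has_derivative_partials)
      (auto simp: C2_on_def differentiable_on_eq_differentiable_at)
  \<comment> \<open>The transpose appears because row \<open>i\<close> of the Jacobian of
    \<open>G\<close> lists the derivatives of \<open>partial i f\<close>, which is column
    \<open>i\<close> of \<open>hessian\<close>. Symmetry is derived from this afterwards.\<close>
  have G: "(G has_derivative (\<lambda>h. transpose (hessian f x) *v h)) (at x)"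
    unfolding has_derivative_componentwise_within[of G]
  proof (intro ballI)
    fix b :: "real^'n" assume "b \<in> Basis"
    then obtain i where b: "b = axis i 1" by (auto simp: Basis_vec_def)
    have "(partial i f has_derivative (\<lambda>h. (\<chi> j. partial j (partial i f) x) \<bullet> h)) (at x)"
      using C2 \<Omega> by (intro has_derivative_partials)
        (auto simp: C2_on_def differentiable_on_eq_differentiable_at)
    moreover have "(\<chi> j. partial j (partial i f) x) \<bullet> h =
        (transpose (hessian f x) *v h) \<bullet> b" for h
    proof -
      have "(transpose (hessian f x) *v h) \<bullet> b = (transpose (hessian f x) *v h) $ i"
        by (simp add: b inner_axis del: transpose_matrix_vector)
      then show ?thesis
        by (simp add: matrix_vector_mult_def hessian_def transpose_def inner_vec_def
            del: transpose_matrix_vector)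
    qed
    moreover have "(\<lambda>y. G y \<bullet> b) = partial i f"
      by (simp add: b G_def inner_axis fun_eq_iff)
    ultimately show "((\<lambda>y. G y \<bullet> b) has_derivative (\<lambda>h. (transpose (hessian f x) *v h) \<bullet> b)) (at x)"
      by simp
  qed
  show sym: "transpose (hessian f x) = hessian f x"
  proof -
    have "(transpose (hessian f x) *v axis j 1) \<bullet> axis i 1 =
        (transpose (hessian f x) *v axis i 1) \<bullet> axis j 1" for i j
      by (rule second_derivative_symmetric[OF r(1) f G])
    then have "transpose (hessian f x) $ i $ j = transpose (hessian f x) $ j $ i" for i j
      by (simp add: inner_axis matrix_vector_mul_component matrix_vector_mult_basis column_def
          del: transpose_matrix_vector)
    then show ?thesis by (simp add: vec_eq_iff transpose_def)
  qed
  show "\<exists>d>0. ball x d \<subseteq> \<Omega> \<and> (\<forall>h. norm h < d \<longrightarrow>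
      \<bar>f (x + h) - f x - (\<chi> i. partial i f x) \<bullet> h - h \<bullet> (hessian f x *v h) / 2\<bar> \<le> e * (h \<bullet> h))"
    if e: "e > 0"
  proof -
    obtain d where d: "d > 0" "d \<le> r" "\<And>h. norm h < d \<Longrightarrow>
        \<bar>f (x + h) - f x - G x \<bullet> h - ((hessian f x *v h) \<bullet> h) / 2\<bar> \<le> e * (h \<bullet> h)"
      using second_order_taylor[OF r(1) f G[unfolded sym] e] by blast
    then show ?thesis
      using r by (intro exI[of _ d]) (auto simp: G_def inner_commute)
  qed
qed

text \<open>A certificate for explicit test functions, with gradient \<open>G\<close> and Hessian
  \<open>L\<close> as maps. It is stable under sums and composition, so second partial derivatives
  never have to be computed by hand.\<close>

definition second_order_data ::
    "(real^'n \<Rightarrow> real) \<Rightarrow> (real^'n \<Rightarrow> real^'n) \<Rightarrow> (real^'n \<Rightarrow> real^'n \<Rightarrow> real^'n) \<Rightarrow> bool" where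
  "second_order_data f G L \<longleftrightarrow>
     (\<forall>x. (f has_derivative (\<lambda>h. G x \<bullet> h)) (at x)) \<and>
     (\<forall>x. (G has_derivative L x) (at x)) \<and>
     (\<forall>h. continuous_on UNIV (\<lambda>x. L x h)) \<and>
     (\<forall>x a b. L x a \<bullet> b = a \<bullet> L x b)"

lemma second_order_data_C2:
  fixes f :: "real^'n \<Rightarrow> real"
  assumes "second_order_data f G L"
  shows "C2_on \<Omega> f" and "transpose (hessian f x) = hessian f x" and "hessian f x *v h = L x h"
proof -
  have f: "(f has_derivative (\<lambda>h. G x \<bullet> h)) (at x)" and G: "(G has_derivative L x) (at x)"
    and L: "continuous_on UNIV (\<lambda>x. L x h)" and sym: "L x a \<bullet> b = a \<bullet> L x b" for x h a b
    using assms unfolding second_order_data_def by blast+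
  have p1: "partial i f = (\<lambda>x. G x $ i)" for i
    by (rule ext) (simp add: partial_def frechet_derivative_at[OF f, symmetric] inner_axis)
  have Gi: "((\<lambda>x. G x $ i) has_derivative (\<lambda>h. L x h $ i)) (at x)" for i x
    by (rule bounded_linear.has_derivative[OF bounded_linear_vec_nth G])
  have p2: "partial i (\<lambda>x. G x $ j) = (\<lambda>x. L x (axis i 1) $ j)" for i j
    by (rule ext) (simp add: partial_def frechet_derivative_at[OF Gi, symmetric])
  show "C2_on \<Omega> f"
    unfolding C2_on_def p1 p2
  proof (intro conjI allI)
    show "f differentiable_on \<Omega>"
      using f by (meson differentiableI differentiable_at_imp_differentiable_on)
    show "(\<lambda>x. G x $ i) differentiable_on \<Omega>" for i
      using Gi by (meson differentiableI differentiable_at_imp_differentiable_on)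
    show "continuous_on \<Omega> (\<lambda>x. L x (axis i 1) $ j)" for i j
      by (intro continuous_intros continuous_on_subset[OF L]) auto
  qed
  have H: "hessian f x $ i $ j = L x (axis i 1) \<bullet> axis j 1" for i j
    by (simp add: hessian_def p1 p2 inner_axis)
  have "hessian f x $ i $ j = hessian f x $ j $ i" for i j
    unfolding H using sym[of x "axis i 1" "axis j 1"] inner_commute[of "axis i 1" "L x (axis j 1)"]
    by simp
  then show "transpose (hessian f x) = hessian f x"
    by (simp add: vec_eq_iff transpose_def)
  have "(hessian f x *v h) $ i = L x (axis i 1) \<bullet> h" for i
    by (simp add: matrix_vector_mult_def H inner_axis) (simp add: inner_vec_def)
  also have "L x (axis i 1) \<bullet> h = L x h $ i" for i
    by (simp add: sym inner_axis')
  finally show "hessian f x *v h = L x h"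
    by (simp add: vec_eq_iff)
qed

lemma second_order_data_add:
  assumes "second_order_data f G L" "second_order_data f' G' L'"
  shows "second_order_data (\<lambda>x. f x + f' x) (\<lambda>x. G x + G' x) (\<lambda>x h. L x h + L' x h)"
  using assms unfolding second_order_data_def inner_add_left inner_add_right
  by (intro conjI allI has_derivative_add continuous_on_add) auto

text \<open>The rank-one term with \<open>\<theta>2\<close> is what makes the barrier convex in the
  radial direction.\<close>

lemma second_order_data_compose:
  assumes data: "second_order_data f G L"
    and t1: "\<And>s. (\<theta> has_real_derivative \<theta>1 s) (at s)"
    and t2: "\<And>s. (\<theta>1 has_real_derivative \<theta>2 s) (at s)"
    and t3: "continuous_on UNIV \<theta>2"
  shows "second_order_data (\<lambda>x. \<theta> (f x)) (\<lambda>x. \<theta>1 (f x) *\<^sub>R G x)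
    (\<lambda>x h. \<theta>1 (f x) *\<^sub>R L x h + (\<theta>2 (f x) * (G x \<bullet> h)) *\<^sub>R G x)"
proof -
  have f: "(f has_derivative (\<lambda>h. G x \<bullet> h)) (at x)" and G: "(G has_derivative L x) (at x)"
    and L: "continuous_on UNIV (\<lambda>x. L x h)" and sym: "L x a \<bullet> b = a \<bullet> L x b" for x h a b
    using data unfolding second_order_data_def by blast+
  have cf: "continuous_on UNIV f"
    by (intro continuous_at_imp_continuous_on ballI has_derivative_continuous[OF f])
  have cG: "continuous_on UNIV G"
    by (intro continuous_at_imp_continuous_on ballI has_derivative_continuous[OF G])
  have ct1: "continuous_on UNIV \<theta>1"
    by (intro continuous_at_imp_continuous_on ballI DERIV_isCont[OF t2])
  have d1: "((\<lambda>x. \<theta> (f x)) has_derivative (\<lambda>h. \<theta>1 (f x) * (G x \<bullet> h))) (at x)" for x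
    using has_derivative_compose[OF f t1[unfolded has_field_derivative_def]] .
  have d2: "((\<lambda>x. \<theta>1 (f x)) has_derivative (\<lambda>h. \<theta>2 (f x) * (G x \<bullet> h))) (at x)" for x
    using has_derivative_compose[OF f t2[unfolded has_field_derivative_def]] .
  have "continuous_on UNIV (\<lambda>x. \<theta>1 (f x))" "continuous_on UNIV (\<lambda>x. \<theta>2 (f x))"
    using continuous_on_compose2[OF ct1 cf] continuous_on_compose2[OF t3 cf] by auto
  then have cont: "continuous_on UNIV
      (\<lambda>x. \<theta>1 (f x) *\<^sub>R L x h + (\<theta>2 (f x) * (G x \<bullet> h)) *\<^sub>R G x)" for h
    by (intro continuous_intros L cG)
  show ?thesis
    unfolding second_order_data_def
  proof (intro conjI allI)
    fix x a b
    show "((\<lambda>x. \<theta> (f x)) has_derivative (\<bullet>) (\<theta>1 (f x) *\<^sub>R G x)) (at x)"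
      by (rule has_derivative_eq_rhs[OF d1]) (simp add: fun_eq_iff)
    show "((\<lambda>x. \<theta>1 (f x) *\<^sub>R G x) has_derivative
        (\<lambda>h. \<theta>1 (f x) *\<^sub>R L x h + (\<theta>2 (f x) * (G x \<bullet> h)) *\<^sub>R G x)) (at x)"
      by (rule has_derivative_eq_rhs[OF has_derivative_scaleR[OF d2 G]]) simp
    show "(\<theta>1 (f x) *\<^sub>R L x a + (\<theta>2 (f x) * (G x \<bullet> a)) *\<^sub>R G x) \<bullet> b =
        a \<bullet> (\<theta>1 (f x) *\<^sub>R L x b + (\<theta>2 (f x) * (G x \<bullet> b)) *\<^sub>R G x)"
      using sym[of x a b] inner_commute[of a "G x"]
      by (simp add: inner_add_left inner_add_right)
  qed (rule cont)
qed

lemma second_order_data_sum_squares: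
  fixes u :: "'i \<Rightarrow> real^'n"
  shows "second_order_data (\<lambda>x. \<Sum>i\<in>K. (u i \<bullet> (x - z))\<^sup>2)
    (\<lambda>x. \<Sum>i\<in>K. (2 * (u i \<bullet> (x - z))) *\<^sub>R u i) (\<lambda>x h. \<Sum>i\<in>K. (2 * (u i \<bullet> h)) *\<^sub>R u i)"
  unfolding second_order_data_def
proof (intro conjI allI)
  fix x
  show "((\<lambda>x. \<Sum>i\<in>K. (u i \<bullet> (x - z))\<^sup>2) has_derivative
      (\<bullet>) (\<Sum>i\<in>K. (2 * (u i \<bullet> (x - z))) *\<^sub>R u i)) (at x)"
    by (auto intro!: derivative_eq_intros sum.cong simp: fun_eq_iff inner_sum_left algebra_simps)
  show "((\<lambda>x. \<Sum>i\<in>K. (2 * (u i \<bullet> (x - z))) *\<^sub>R u i) has_derivative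
      (\<lambda>h. \<Sum>i\<in>K. (2 * (u i \<bullet> h)) *\<^sub>R u i)) (at x)"
    by (auto intro!: derivative_eq_intros sum.cong simp: fun_eq_iff)
qed (auto simp: inner_sum_left inner_sum_right inner_commute mult_ac)

text \<open>Three is the least integer power for which the positive part is C^2. Only the corner
  \<open>s = a\<close> needs a difference quotient; elsewhere the function agrees locally with 0 or
  a polynomial.\<close>

lemma max_cube_derivatives:
  fixes a :: real
  shows "((\<lambda>s. (max (s - a) 0) ^ 3) has_real_derivative 3 * (max (s - a) 0)\<^sup>2) (at s)"
    and "((\<lambda>s. 3 * (max (s - a) 0)\<^sup>2) has_real_derivative 6 * max (s - a) 0) (at s)"
proof -
  have *: "((\<lambda>s. (max (s - a) 0) ^ Suc (Suc n)) has_real_derivative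
      real (Suc (Suc n)) * (max (s - a) 0) ^ Suc n) (at s)" for n
  proof (cases "s = a")
    case True
    have "((\<lambda>h. (max h 0) ^ Suc (Suc n) / h) \<longlongrightarrow> 0) (at (0::real))"
    proof (rule tendsto_rabs_zero_cancel, rule tendsto_sandwich[of "\<lambda>_. 0"])
      show "\<forall>\<^sub>F h in at (0::real). \<bar>(max h 0) ^ Suc (Suc n) / h\<bar> \<le> \<bar>h\<bar> ^ Suc n"
        by (rule always_eventually) (auto simp: max_def abs_mult power_abs mult_nonpos_nonneg)
      show "((\<lambda>h. \<bar>h\<bar> ^ Suc n) \<longlongrightarrow> 0) (at (0::real))"
        by (rule tendsto_eq_intros | simp)+
    qed auto
    then show ?thesis using True by (simp add: DERIV_def)
  next
    case False
    show ?thesis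
    proof (cases "s < a")
      case True
      have "((\<lambda>s. (max (s - a) 0) ^ Suc (Suc n)) has_real_derivative 0) (at s)"
        by (rule has_field_derivative_transform_within_open[of "\<lambda>_. 0" _ _ "{..<a}"])
          (use True in auto)
      then show ?thesis using True by simp
    next
      case gt: False
      have "((\<lambda>s. (s - a) ^ Suc (Suc n)) has_real_derivative
          real (Suc (Suc n)) * (s - a) ^ Suc n) (at s)"
        by (rule DERIV_cong, rule DERIV_power[where D = 1])
          (auto intro!: derivative_eq_intros simp del: of_nat_Suc)
      then have "((\<lambda>s. (max (s - a) 0) ^ Suc (Suc n)) has_real_derivative
          real (Suc (Suc n)) * (s - a) ^ Suc n) (at s)"
        by (rule has_field_derivative_transform_within_open[of _ _ _ "{a<..}"])
          (use gt False in auto)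
      then show ?thesis using gt by simp
    qed
  qed
  show "((\<lambda>s. (max (s - a) 0) ^ 3) has_real_derivative 3 * (max (s - a) 0)\<^sup>2) (at s)"
    using *[of 1] by (simp add: numeral_3_eq_3 numeral_2_eq_2)
  show "((\<lambda>s. 3 * (max (s - a) 0)\<^sup>2) has_real_derivative 6 * max (s - a) 0) (at s)"
    using DERIV_cmult[OF *[of 0], of 3] by (simp add: numeral_2_eq_2)
qed

subsection \<open>Cylinders in orthonormal coordinates\<close>

text \<open>The squared length of the projection of \<open>x - z\<close> to the span of the
  \<open>u i\<close> with \<open>i\<close> in \<open>K\<close>. Squares keep it polynomial, hence
  smooth also where it vanishes.\<close>

definition coord_sq :: "('n::finite \<Rightarrow> real^'n) \<Rightarrow> 'n set \<Rightarrow> real^'n \<Rightarrow> real^'n \<Rightarrow> real" where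
  "coord_sq u K z x = (\<Sum>i\<in>K. (u i \<bullet> (x - z))\<^sup>2)"

lemma coord_sq_nonneg: "0 \<le> coord_sq u K z x"
  by (simp add: coord_sq_def sum_nonneg)

lemma continuous_coord_sq [continuous_intros]: "continuous_on S (coord_sq u K z)"
  unfolding coord_sq_def by (intro continuous_intros)

lemma coord_sq_add_compl:
  assumes "orthonormal_family u"
  shows "coord_sq u K z x + coord_sq u (- K) z x = (x - z) \<bullet> (x - z)"
proof -
  have "coord_sq u K z x + coord_sq u (- K) z x = (\<Sum>i\<in>K \<union> - K. (u i \<bullet> (x - z))\<^sup>2)"
    unfolding coord_sq_def by (rule sum.union_disjoint[symmetric]) auto
  then show ?thesis
    by (simp add: orthonormal_inner[OF assms, of "x - z" "x - z"] power2_eq_square)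
qed

text \<open>An arbitrary relation \<open>R\<close> covers the cylinder and its lateral boundary at
  once.\<close>

lemma image_coord_sq:
  fixes Q :: "real^'n^'n"
  assumes Q: "orthogonal_matrix Q"
  defines "u \<equiv> \<lambda>i. column i Q"
  shows "(\<lambda>x. z + Q *v x) ` {x. R (L2_set (($) x) K) (L2_set (($) x) (- K))} =
    {x. R (sqrt (coord_sq u K z x)) (sqrt (coord_sq u (- K) z x))}" (is "?L = ?R")
proof -
  have u: "orthonormal_family u" unfolding u_def by (rule orthonormal_family_column[OF Q])
  have coord: "u i \<bullet> (Q *v w) = w $ i" for w i
    using orthonormal_coord_sum[OF u, of i "\<lambda>j. w $ j" UNIV]
    by (simp add: matrix_vector_mult_columns u_def)
  have L2: "L2_set (($) w) S = sqrt (coord_sq u S z (z + Q *v w))" for w S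
    by (simp add: L2_set_def coord_sq_def coord)
  show ?thesis
  proof
    show "?L \<subseteq> ?R" by (auto simp: L2)
    show "?R \<subseteq> ?L"
    proof
      fix x assume x: "x \<in> ?R"
      define w where "w = (\<chi> i. u i \<bullet> (x - z))"
      have "Q *v w = x - z"
        using orthonormal_expansion[OF u, of "x - z"]
        by (simp add: matrix_vector_mult_columns w_def u_def)
      then have "x = z + Q *v w" by simp
      then show "x \<in> ?L" using x by (auto simp: L2)
    qed
  qed
qed

lemma sqrt_le_iff_le_square: "0 \<le> a \<Longrightarrow> sqrt x \<le> a \<longleftrightarrow> x \<le> a\<^sup>2"
  by (metis real_sqrt_abs real_sqrt_le_iff abs_of_nonneg)

lemma sqrt_eq_iff_eq_square: "0 \<le> a \<Longrightarrow> sqrt x = a \<longleftrightarrow> x = a\<^sup>2"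
  by (metis real_sqrt_abs real_sqrt_eq_iff abs_of_nonneg)

lemma mem_cylinder_iff:
  assumes "orthogonal_matrix Q" "0 \<le> a" "0 \<le> b"
  shows "x \<in> cylinder z Q K a b \<longleftrightarrow>
    coord_sq (\<lambda>i. column i Q) K z x \<le> a\<^sup>2 \<and> coord_sq (\<lambda>i. column i Q) (- K) z x \<le> b\<^sup>2"
  unfolding cylinder_def
    image_coord_sq[OF assms(1), where R = "\<lambda>s t. s \<le> a \<and> t \<le> b"]
  using assms by (simp add: sqrt_le_iff_le_square)

lemma mem_lateral_boundary_iff:
  assumes "orthogonal_matrix Q" "0 \<le> a" "0 \<le> b"
  shows "x \<in> lateral_boundary z Q K a b \<longleftrightarrow>
    coord_sq (\<lambda>i. column i Q) K z x = a\<^sup>2 \<and> coord_sq (\<lambda>i. column i Q) (- K) z x \<le> b\<^sup>2"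
  unfolding lateral_boundary_def
    image_coord_sq[OF assms(1), where R = "\<lambda>s t. s = a \<and> t \<le> b"]
  using assms by (simp add: sqrt_le_iff_le_square sqrt_eq_iff_eq_square)

lemma compact_coord_sq_box:
  assumes u: "orthonormal_family u"
  shows "compact {x. coord_sq u K z x \<le> s \<and> coord_sq u (- K) z x \<le> t}"
proof -
  let ?B = "{x. coord_sq u K z x \<le> s \<and> coord_sq u (- K) z x \<le> t}"
  have "closed ?B"
    by (intro closed_Collect_conj closed_Collect_le continuous_intros)
  moreover have "?B \<subseteq> cball z (sqrt (s + t))"
  proof
    fix x assume "x \<in> ?B"
    then have "(norm (x - z))\<^sup>2 \<le> s + t"
      using coord_sq_add_compl[OF u, of K z x] by (simp add: power2_norm_eq_inner)
    then show "x \<in> cball z (sqrt (s + t))"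
      by (simp add: dist_norm norm_minus_commute real_le_rsqrt)
  qed
  ultimately show ?thesis
    using bounded_subset bounded_cball compact_eq_bounded_closed by blast
qed

lemma compact_positive_lower_bound:
  fixes g :: "'a::topological_space \<Rightarrow> real"
  assumes "compact S" "continuous_on S g" "\<And>x. x \<in> S \<Longrightarrow> 0 < g x"
  obtains m where "0 < m" "\<And>x. x \<in> S \<Longrightarrow> m \<le> g x"
proof (cases "S = {}")
  case True
  then show thesis using that[of 1] by simp
next
  case False
  obtain x where "x \<in> S" "\<forall>y\<in>S. g x \<le> g y"
    using continuous_attains_inf[OF assms(1) False assms(2)] by blast
  then show thesis using that[of "g x"] assms(3) by blast
qed

subsection \<open>The second-order condition implies the cylinder condition\<close>

text \<open>This is the second derivative of exp (- s / b^2), with value \<open>E\<close>, along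
  \<tau> times the radial vector: slope times Hessian of \<open>s\<close>, plus curvature times
  squared gradient. It factors through \<open>2 * s - b\<^sup>2\<close>, so it is positive well
  inside the wall already.\<close>

lemma radial_Hessian_nonneg:
  fixes b \<tau> s E :: real
  assumes "0 < b" "b\<^sup>2 \<le> s" "0 < E"
  shows "0 \<le> - E / b\<^sup>2 * (2 * (\<tau>\<^sup>2 * s)) + E / b ^ 4 * (2 * \<tau> * s)\<^sup>2"
    and "\<tau> \<noteq> 0 \<Longrightarrow> 0 < - E / b\<^sup>2 * (2 * (\<tau>\<^sup>2 * s)) + E / b ^ 4 * (2 * \<tau> * s)\<^sup>2"
proof -
  have b4: "b ^ 4 = b\<^sup>2 * b\<^sup>2" by (simp add: power2_eq_square power4_eq_xxxx)
  have eq: "- E / b\<^sup>2 * (2 * (\<tau>\<^sup>2 * s)) + E / b ^ 4 * (2 * \<tau> * s)\<^sup>2 =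
      (2 * E * \<tau>\<^sup>2 * s / (b\<^sup>2 * b\<^sup>2)) * (2 * s - b\<^sup>2)"
    unfolding b4 using assms by (simp add: field_simps power2_eq_square)
  have "0 < b\<^sup>2" using assms by simp
  then have s: "0 < s" "0 < 2 * s - b\<^sup>2" using assms by linarith+
  show "0 \<le> - E / b\<^sup>2 * (2 * (\<tau>\<^sup>2 * s)) + E / b ^ 4 * (2 * \<tau> * s)\<^sup>2"
    unfolding eq using assms s by (intro mult_nonneg_nonneg divide_nonneg_nonneg) auto
  show "\<tau> \<noteq> 0 \<Longrightarrow> 0 < - E / b\<^sup>2 * (2 * (\<tau>\<^sup>2 * s)) + E / b ^ 4 * (2 * \<tau> * s)\<^sup>2"
    unfolding eq using assms s by (intro mult_pos_pos divide_pos_pos) auto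
qed

text \<open>Here \<open>t\<close> is the excess over the lateral boundary, and 1 bounds the
  exponential. Of the expanded cube only \<open>d ^ 3\<close> and \<open>3 * d\<^sup>2 * t\<close>
  are kept; the two summands of \<open>M\<close> are made for them and absorb the constant
  \<open>1 + e * a2\<close> and the slope \<open>e\<close>.\<close>

lemma penalty_dominates:
  fixes d t e a2 :: real
  assumes "0 < d" "0 \<le> t" "0 < e" "0 \<le> a2"
  defines "M \<equiv> (1 + e * a2) / d ^ 3 + e / (3 * d\<^sup>2)"
  shows "1 + e * (a2 + t) - M * (t + d) ^ 3 \<le> 0"
proof -
  have M: "0 \<le> M" unfolding M_def using assms by (intro add_nonneg_nonneg) auto
  have "(t + d) ^ 3 = d ^ 3 + 3 * d\<^sup>2 * t + (t ^ 3 + 3 * d * t\<^sup>2)"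
    by (simp add: power3_eq_cube power2_eq_square algebra_simps)
  then have "d ^ 3 + 3 * d\<^sup>2 * t \<le> (t + d) ^ 3" using assms by simp
  then have "M * (d ^ 3 + 3 * d\<^sup>2 * t) \<le> M * (t + d) ^ 3"
    using M by (rule mult_left_mono)
  moreover have "1 + e * (a2 + t) \<le> M * (d ^ 3 + 3 * d\<^sup>2 * t)"
  proof -
    have "M * d ^ 3 = (1 + e * a2) + e * d / 3"
      unfolding M_def using assms by (simp add: field_simps power2_eq_square power3_eq_cube)
    moreover have "M * (3 * d\<^sup>2) = 3 * (1 + e * a2) / d + e"
      unfolding M_def using assms by (simp add: field_simps power2_eq_square power3_eq_cube)
    moreover have "M * (d ^ 3 + 3 * d\<^sup>2 * t) = M * d ^ 3 + M * (3 * d\<^sup>2) * t"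
      by (simp add: algebra_simps)
    ultimately have "M * (d ^ 3 + 3 * d\<^sup>2 * t) =
        1 + e * a2 + e * t + (e * d / 3 + 3 * (1 + e * a2) / d * t)"
      by (simp add: algebra_simps)
    moreover have "0 \<le> e * d / 3 + 3 * (1 + e * a2) / d * t"
      using assms by (intro add_nonneg_nonneg mult_nonneg_nonneg divide_nonneg_nonneg) auto
    ultimately show ?thesis by (simp add: algebra_simps)
  qed
  ultimately show ?thesis by linarith
qed

text \<open>
  Outside the open cylinder, \<open>exp (- s / b\<^sup>2)\<close> is convex in the radial direction, where \<open>s\<close> is the
  squared distance from the axis plane. The term with \<open>M\<close> is the penalty, inactive at \<open>x\<close>.
\<close>
lemma barrier_eigval_pos:
  fixes u :: "'n::finite \<Rightarrow> real^'n" and c M :: real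
  assumes u: "orthonormal_family u" and b: "0 < b" and e: "0 < e"
    and x: "b\<^sup>2 \<le> coord_sq u (- K) z x" "coord_sq u K z x < \<alpha>"
  defines "\<phi> \<equiv> \<lambda>y. (exp (- coord_sq u (- K) z y / b\<^sup>2) - c) +
      (e * coord_sq u K z y - M * (max (coord_sq u K z y - \<alpha>) 0) ^ 3)"
  shows "C2_on \<Omega> \<phi>" and "0 < eigval (CARD('n) - card K) (hessian \<phi> x)"
proof -
  define \<theta>1 where "\<theta>1 s = exp (- s / b\<^sup>2) - c" for s
  define \<theta>1' where "\<theta>1' s = - exp (- s / b\<^sup>2) / b\<^sup>2" for s
  define \<theta>1'' where "\<theta>1'' s = exp (- s / b\<^sup>2) / b ^ 4" for s
  define \<theta>2 where "\<theta>2 s = e * s - M * (max (s - \<alpha>) 0) ^ 3" for s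
  define \<theta>2' where "\<theta>2' s = e - M * (3 * (max (s - \<alpha>) 0)\<^sup>2)" for s
  define \<theta>2'' where "\<theta>2'' s = - (M * (6 * max (s - \<alpha>) 0))" for s
  have t1: "(\<theta>1 has_real_derivative \<theta>1' s) (at s)" "(\<theta>1' has_real_derivative \<theta>1'' s) (at s)" for s
    unfolding \<theta>1_def \<theta>1'_def \<theta>1''_def using b
    by (auto intro!: derivative_eq_intros simp: field_simps power2_eq_square power4_eq_xxxx)
  have t2: "(\<theta>2 has_real_derivative \<theta>2' s) (at s)" "(\<theta>2' has_real_derivative \<theta>2'' s) (at s)" for s
    unfolding \<theta>2_def \<theta>2'_def \<theta>2''_def
    by (rule derivative_eq_intros max_cube_derivatives refl | simp)+
  have t3: "continuous_on UNIV \<theta>1''" "continuous_on UNIV \<theta>2''"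
    unfolding \<theta>1''_def \<theta>2''_def using b by (auto intro!: continuous_intros)
  define Gw where "Gw y = (\<Sum>i\<in>- K. (2 * (u i \<bullet> (y - z))) *\<^sub>R u i)" for y
  define Gy where "Gy y = (\<Sum>i\<in>K. (2 * (u i \<bullet> (y - z))) *\<^sub>R u i)" for y
  define Lw where "Lw h = (\<Sum>i\<in>- K. (2 * (u i \<bullet> h)) *\<^sub>R u i)" for h
  define Ly where "Ly h = (\<Sum>i\<in>K. (2 * (u i \<bullet> h)) *\<^sub>R u i)" for h
  have "second_order_data (coord_sq u (- K) z) Gw (\<lambda>_. Lw)"
    "second_order_data (coord_sq u K z) Gy (\<lambda>_. Ly)"
    unfolding coord_sq_def Gw_def Gy_def Lw_def Ly_def
    by (rule second_order_data_sum_squares)+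
  note data = second_order_data_add[OF
      second_order_data_compose[OF this(1) t1 t3(1)] second_order_data_compose[OF this(2) t2 t3(2)]]
  have \<phi>: "\<phi> = (\<lambda>y. \<theta>1 (coord_sq u (- K) z y) + \<theta>2 (coord_sq u K z y))"
    by (simp add: \<phi>_def \<theta>1_def \<theta>2_def)
  show "C2_on \<Omega> \<phi>"
    unfolding \<phi> by (rule second_order_data_C2(1)[OF data])
  let ?sw = "coord_sq u (- K) z x" and ?sy = "coord_sq u K z x"
  have d2: "\<theta>2' ?sy = e" "\<theta>2'' ?sy = 0"
    using x(2) by (simp_all add: \<theta>2'_def \<theta>2''_def)
  have hess: "hessian \<phi> x *v h = (\<theta>1' ?sw *\<^sub>R Lw h + (\<theta>1'' ?sw * (Gw x \<bullet> h)) *\<^sub>R Gw x) + e *\<^sub>R Ly h"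
    for h
    unfolding \<phi> using second_order_data_C2(3)[OF data, of x h] by (simp add: d2)
  define w where "w = (\<Sum>i\<in>- K. (u i \<bullet> (x - z)) *\<^sub>R u i)"
  have uw: "u i \<bullet> w = (if i \<in> K then 0 else u i \<bullet> (x - z))" for i
    by (simp add: w_def orthonormal_coord_sum[OF u])
  \<comment> \<open>The axis directions together with the radial vector \<open>w\<close> give
    \<open>card K + 1\<close> dimensions. Outside \<open>K\<close>, a vector of \<open>?V\<close>
    has the coordinates of a multiple of \<open>w\<close>.\<close>
  let ?V = "span (insert w (u ` K))"
  have "0 < b\<^sup>2" using b by simp
  then have sw: "0 < ?sw" using x(1) by linarith
  have ww: "w \<bullet> w = ?sw"
    unfolding orthonormal_inner[OF u, of w w] coord_sq_def
    by (rule sum.mono_neutral_cong_right) (auto simp: uw power2_eq_square)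
  have dimV: "card K < dim ?V"
  proof -
    have wK: "w \<notin> u ` K"
    proof
      assume "w \<in> u ` K"
      then obtain i where "i \<in> K" "w = u i" by blast
      then show False using uw[of i] u by (metis orthonormal_family_def zero_neq_one)
    qed
    have "pairwise orthogonal (insert w (u ` K))"
      unfolding pairwise_insert
      using u uw by (auto simp: pairwise_def orthogonal_def orthonormal_family_def inner_commute)
    moreover have "u i \<noteq> 0" for i
      using u by (metis inner_zero_left orthonormal_family_def zero_neq_one)
    then have "0 \<notin> insert w (u ` K)"
      using ww sw by force
    ultimately have "independent (insert w (u ` K))"
      by (rule pairwise_orthogonal_independent)
    then have "dim ?V = card (insert w (u ` K))"
      by (simp add: dim_eq_card_independent)
    also have "\<dots> = Suc (card K)"
      using wK card_image[OF inj_on_subset[OF orthonormal_family_inj[OF u]], of K] by simp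
    finally show ?thesis by simp
  qed
  show "0 < eigval (CARD('n) - card K) (hessian \<phi> x)"
  proof (rule eigval_pos_if_positive_on_subspace[OF _ subspace_span dimV])
    show "transpose (hessian \<phi> x) = hessian \<phi> x"
      unfolding \<phi> by (rule second_order_data_C2(2)[OF data])
    fix h assume hV: "h \<in> ?V" and h0: "h \<noteq> 0"
    obtain \<tau> where hw: "h - \<tau> *\<^sub>R w \<in> span (u ` K)"
      using hV by (auto simp: span_insert)
    then have \<tau>: "u i \<bullet> h = \<tau> * (u i \<bullet> (x - z))" if "i \<notin> K" for i
      using span_orthonormal_coord[OF u hw that] uw[of i] that by (simp add: inner_diff_right)
    have "(\<Sum>i\<in>- K. (u i \<bullet> h)\<^sup>2) = (\<Sum>i\<in>- K. \<tau>\<^sup>2 * (u i \<bullet> (x - z))\<^sup>2)"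
      by (rule sum.cong) (auto simp: \<tau> power_mult_distrib)
    then have A: "(\<Sum>i\<in>- K. (u i \<bullet> h)\<^sup>2) = \<tau>\<^sup>2 * ?sw"
      by (simp add: coord_sq_def sum_distrib_left)
    have "Gw x \<bullet> h = (\<Sum>i\<in>- K. (2 * \<tau>) * (u i \<bullet> (x - z))\<^sup>2)"
      unfolding Gw_def inner_sum_left
      by (rule sum.cong) (auto simp: \<tau> power2_eq_square)
    then have B: "Gw x \<bullet> h = 2 * \<tau> * ?sw"
      by (simp add: coord_sq_def sum_distrib_left)
    have Lw: "h \<bullet> Lw h = 2 * (\<tau>\<^sup>2 * ?sw)" and Ly: "h \<bullet> Ly h = 2 * (\<Sum>i\<in>K. (u i \<bullet> h)\<^sup>2)"
      unfolding Lw_def Ly_def A[symmetric]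
      by (simp_all add: inner_sum_right inner_commute sum_distrib_left power2_eq_square mult.assoc)
    have eq: "h \<bullet> (hessian \<phi> x *v h) =
        (- exp (- ?sw / b\<^sup>2) / b\<^sup>2 * (2 * (\<tau>\<^sup>2 * ?sw)) + exp (- ?sw / b\<^sup>2) / b ^ 4 * (2 * \<tau> * ?sw)\<^sup>2)
        + e * (2 * (\<Sum>i\<in>K. (u i \<bullet> h)\<^sup>2))" (is "_ = ?X + ?Y")
      unfolding hess inner_add_right inner_scaleR_right Lw Ly inner_commute[of h "Gw x"] B
      by (simp add: \<theta>1'_def \<theta>1''_def power2_eq_square)
    have X: "0 \<le> ?X" by (rule radial_Hessian_nonneg(1)[OF b x(1)]) simp
    have Y: "0 \<le> ?Y" using e by (simp add: sum_nonneg)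
    show "0 < h \<bullet> (hessian \<phi> x *v h)"
    \<comment> \<open>A nonzero radial part makes \<open>?X\<close> positive; without it
      \<open>h\<close> lies in the axis directions, where the \<open>e\<close> term is
      positive.\<close>
    proof (cases "\<tau> = 0")
      case False
      have "0 < ?X" by (rule radial_Hessian_nonneg(2)[OF b x(1) _ False]) simp
      then show ?thesis using Y unfolding eq by linarith
    next
      case True
      have "h \<bullet> h = (\<Sum>i\<in>K \<union> - K. (u i \<bullet> h)\<^sup>2)"
        by (simp add: orthonormal_inner[OF u, of h h] power2_eq_square)
      also have "\<dots> = (\<Sum>i\<in>K. (u i \<bullet> h)\<^sup>2) + (\<Sum>i\<in>- K. (u i \<bullet> h)\<^sup>2)"
        by (rule sum.union_disjoint) auto
      also have "\<dots> = (\<Sum>i\<in>K. (u i \<bullet> h)\<^sup>2)"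
        using A True by simp
      finally have "0 < (\<Sum>i\<in>K. (u i \<bullet> h)\<^sup>2)" using h0 by (metis inner_gt_zero_iff)
      then have "0 < ?Y" using e by simp
      then show ?thesis using X unfolding eq by linarith
    qed
  qed
qed

theorem cond_G_imp_cond_C:
  fixes \<Omega> U :: "(real^'n) set"
  assumes \<Omega>: "open \<Omega>" and U: "open U" and G: "cond_G (CARD('n) - k) \<Omega> U"
  shows "cond_C k \<Omega> U"
  unfolding cond_C_def
proof (intro allI impI, elim conjE)
  fix z and Q :: "real^'n^'n" and K a b
  assume Q: "orthogonal_matrix Q" and K: "card K = k" and a: "0 < a" and b: "0 < b"
    and cyl: "cylinder z Q K a b \<subseteq> \<Omega>"
    and latint: "lateral_boundary z Q K a b \<union> interior (cylinder z Q K a b) \<subseteq> U"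
  define u where "u = (\<lambda>i. column i Q)"
  have u: "orthonormal_family u"
    unfolding u_def by (rule orthonormal_family_column[OF Q])
  define sy where "sy = coord_sq u K z"
  define sw where "sw = coord_sq u (- K) z"
  have cont: "continuous_on S sy" "continuous_on S sw" for S
    unfolding sy_def sw_def by (rule continuous_coord_sq)+
  have C: "x \<in> cylinder z Q K a b \<longleftrightarrow> sy x \<le> a\<^sup>2 \<and> sw x \<le> b\<^sup>2" for x
    using mem_cylinder_iff[OF Q, of a b x z K] a b by (simp add: sy_def sw_def u_def)
  have lat: "x \<in> U" if "sy x = a\<^sup>2" "sw x \<le> b\<^sup>2" for x
    using mem_lateral_boundary_iff[OF Q, of a b x z K] a b latint that
    by (auto simp: sy_def sw_def u_def)
  have int: "x \<in> U" if "sy x < a\<^sup>2" "sw x < b\<^sup>2" for x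
  proof -
    let ?I = "{x. sy x < a\<^sup>2 \<and> sw x < b\<^sup>2}"
    have "open ?I" by (intro open_Collect_conj open_Collect_less continuous_intros cont)
    moreover have "?I \<subseteq> cylinder z Q K a b" by (rule subsetI) (simp add: C)
    ultimately have "?I \<subseteq> interior (cylinder z Q K a b)" by (simp only: interior_maximal)
    then show ?thesis using that latint by blast
  qed
  show "cylinder z Q K a b \<subseteq> U"
  proof (rule ccontr)
    assume "\<not> ?thesis"
    then obtain x0 where x0: "x0 \<notin> U" "sy x0 \<le> a\<^sup>2" "sw x0 \<le> b\<^sup>2"
      using C by blast
    then have sw0: "sw x0 = b\<^sup>2" using lat[of x0] int[of x0] by force
    define Box where "Box t = {x. sy x \<le> a\<^sup>2 \<and> sw x \<le> t}" for t
    have compBox: "compact (Box t)" for t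
      unfolding Box_def sy_def sw_def by (rule compact_coord_sq_box[OF u])
    have comp: "compact (Box t - S)" if "open S" for t S
      using compBox that by (rule compact_diff)
    \<comment> \<open>Since the cylinder lies in \<Omega>, points of the taller box outside \<Omega>
      lie beyond the wall level; compactness makes the gap uniform.\<close>
    have pos1: "0 < sw x - b\<^sup>2" if "x \<in> Box (b\<^sup>2 + 1) - \<Omega>" for x
      using C[of x] cyl that by (force simp: Box_def)
    have c1: "continuous_on (Box (b\<^sup>2 + 1) - \<Omega>) (\<lambda>x. sw x - b\<^sup>2)"
      by (intro continuous_intros cont)
    obtain m1 where m1: "0 < m1" "\<And>x. x \<in> Box (b\<^sup>2 + 1) - \<Omega> \<Longrightarrow> m1 \<le> sw x - b\<^sup>2"
      using compact_positive_lower_bound[OF comp[OF \<Omega>] c1] pos1 by blast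
    \<comment> \<open>The lateral hypothesis enters here: if the maximum were nonpositive, the point
      would lie on the lateral boundary, hence in \<open>U\<close>.\<close>
    have pos2: "0 < max (a\<^sup>2 - sy x) (sw x - b\<^sup>2)" if "x \<in> Box (b\<^sup>2 + 1) - U" for x
      using lat[of x] that by (force simp: Box_def)
    have c2: "continuous_on (Box (b\<^sup>2 + 1) - U) (\<lambda>x. max (a\<^sup>2 - sy x) (sw x - b\<^sup>2))"
      by (intro continuous_intros cont)
    obtain m2 where m2: "0 < m2"
      "\<And>x. x \<in> Box (b\<^sup>2 + 1) - U \<Longrightarrow> m2 \<le> max (a\<^sup>2 - sy x) (sw x - b\<^sup>2)"
      using compact_positive_lower_bound[OF comp[OF U] c2] pos2 by blast
    \<comment> \<open>The box may reach beyond the wall by at most 1, so that \<open>m1\<close> and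
      \<open>m2\<close> apply, by less than \<open>m1\<close>, so that it stays in \<Omega>, and by
      less than \<open>m2\<close>, so that \<open>sy x \<le> a\<^sup>2 - m2\<close> off
      \<open>U\<close>. Halfway between this level and \<open>a\<^sup>2\<close> lies \<alpha>: the
      penalty vanishes on \<open>T\<close> but is active at the lateral boundary.\<close>
    define \<beta> where "\<beta> = b\<^sup>2 + min 1 (min (m1 / 2) (m2 / 2))"
    define \<alpha> where "\<alpha> = a\<^sup>2 - m2 / 2"
    have \<beta>: "b\<^sup>2 < \<beta>" "\<beta> \<le> b\<^sup>2 + 1" "\<beta> < b\<^sup>2 + m1" "\<beta> < b\<^sup>2 + m2"
      using m1(1) m2(1) by (auto simp: \<beta>_def)
    define T where "T = Box \<beta> - U"
    have T\<Omega>: "x \<in> \<Omega>" if "x \<in> T" for x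
      using m1(2)[of x] that \<beta> by (force simp: T_def Box_def)
    have T\<alpha>: "sy x < \<alpha>" if "x \<in> T" for x
      using m2(2)[of x] that \<beta> m2(1) by (force simp: T_def Box_def \<alpha>_def)
    \<comment> \<open>Being away from the lateral boundary, a point of \<open>T\<close> with smaller
      \<open>sw\<close> would lie in the open cylinder. Hence \<open>T\<close> lies where the
      exponential is radially convex.\<close>
    have Tsw: "b\<^sup>2 \<le> sw x" if "x \<in> T" for x
      using int[of x] that T\<alpha>[OF that] m2(1) by (force simp: T_def \<alpha>_def)
    have x0T: "x0 \<in> T" using x0 \<beta> by (simp add: T_def Box_def)
    \<comment> \<open>Chosen so that beyond \<beta>, with \<open>sy x \<le> a\<^sup>2\<close>, the
      function stays at most \<open>exp (- 1)\<close>, the value of the exponential on the wall. It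
      is positive because \<beta> exceeds \<open>b\<^sup>2\<close>.\<close>
    define e where "e = (exp (- 1) - exp (- \<beta> / b\<^sup>2)) / a\<^sup>2"
    have e: "0 < e" "exp (- \<beta> / b\<^sup>2) + e * a\<^sup>2 = exp (- 1)"
      using a b \<beta> by (auto simp: e_def less_divide_eq)
    define d where "d = m2 / 2"
    define M where "M = (1 + e * a\<^sup>2) / d ^ 3 + e / (3 * d\<^sup>2)"
    define f where "f x = exp (- sw x / b\<^sup>2) + (e * sy x - M * (max (sy x - \<alpha>) 0) ^ 3)" for x
    have "0 < d" using m2 by (simp add: d_def)
    then have M: "0 \<le> M" using e(1) by (simp add: M_def)
    have sy0: "0 \<le> sy x" and sw_nonneg: "0 \<le> sw x" for x
      by (simp_all add: sy_def sw_def coord_sq_nonneg)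
    have contf: "continuous_on T f"
      unfolding f_def using b by (intro continuous_intros cont) auto
    have "T \<noteq> {}" using x0T by blast
    then obtain x1 where x1: "x1 \<in> T" and max1: "\<forall>x\<in>T. f x \<le> f x1"
      using continuous_attains_sup[of T f] comp[OF U] contf unfolding T_def by blast
    have "f x0 \<ge> exp (- 1)"
      using sw0 b T\<alpha>[OF x0T] e(1) sy0[of x0] by (simp add: f_def)
    then have f1: "exp (- 1) \<le> f x1" using max1 x0T by force
    have glob: "f x \<le> f x1" if x: "x \<in> \<Omega> - U" for x
    proof -
      \<comment> \<open>In the box the maximum over \<open>T\<close> decides. Past \<beta> the
        choice of \<open>e\<close>, and past the lateral boundary the penalty, keep \<open>f\<close>
        at most \<open>exp (- 1)\<close>, which \<open>f x0\<close> already reaches.\<close>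
      consider "sy x \<le> a\<^sup>2" "sw x \<le> \<beta>" | "sy x \<le> a\<^sup>2" "\<beta> < sw x" | "a\<^sup>2 < sy x" by linarith
      then show ?thesis
      proof cases
        case 1
        then have "x \<in> T" using x by (simp add: T_def Box_def)
        then show ?thesis using max1 by blast
      next
        case 2
        have "exp (- sw x / b\<^sup>2) \<le> exp (- \<beta> / b\<^sup>2)"
          using 2 b by (simp add: divide_right_mono)
        moreover have "e * sy x \<le> e * a\<^sup>2" using 2 e by simp
        moreover have "0 \<le> M * (max (sy x - \<alpha>) 0) ^ 3" using M by simp
        ultimately have "f x \<le> exp (- 1)" using e(2) unfolding f_def by linarith
        then show ?thesis using f1 by linarith
      next
        case 3
        have "exp (- sw x / b\<^sup>2) \<le> 1" using sw_nonneg[of x] by simp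
        moreover have "max (sy x - \<alpha>) 0 = (sy x - a\<^sup>2) + d"
          using 3 m2 by (simp add: \<alpha>_def d_def)
        then have "f x = exp (- sw x / b\<^sup>2) + (e * sy x - M * ((sy x - a\<^sup>2) + d) ^ 3)"
          by (simp only: f_def)
        moreover have "1 + e * (a\<^sup>2 + (sy x - a\<^sup>2)) - M * ((sy x - a\<^sup>2) + d) ^ 3 \<le> 0"
          unfolding M_def using 3 e \<open>0 < d\<close> by (intro penalty_dominates) auto
        then have "1 + e * sy x - M * ((sy x - a\<^sup>2) + d) ^ 3 \<le> 0" by simp
        ultimately have "f x \<le> 0" by linarith
        then show ?thesis using f1 exp_gt_zero[of "- 1"] by linarith
      qed
    qed
    define \<phi> where "\<phi> y = (exp (- coord_sq u (- K) z y / b\<^sup>2) - f x1) +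
      (e * coord_sq u K z y - M * (max (coord_sq u K z y - \<alpha>) 0) ^ 3)" for y
    have \<phi>: "\<phi> y = f y - f x1" for y
      by (simp add: \<phi>_def f_def sy_def sw_def)
    have C2: "C2_on \<Omega> \<phi>" and pos: "0 < eigval (CARD('n) - card K) (hessian \<phi> x1)"
      unfolding \<phi>_def
      using barrier_eigval_pos[OF u b e(1), of K z x1 \<alpha>] Tsw[OF x1] T\<alpha>[OF x1]
      unfolding sy_def sw_def by blast+
    have "x1 \<in> \<Omega> - U" using T\<Omega>[OF x1] x1 by (simp add: T_def)
    moreover have "\<forall>y\<in>\<Omega> - U. \<phi> y \<le> \<phi> x1" "\<phi> x1 = 0" using glob by (auto simp: \<phi>)
    ultimately have "eigval (CARD('n) - k) (hessian \<phi> x1) \<le> 0"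
      using G C2 unfolding cond_G_def by blast
    then show False using pos K by simp
  qed
qed

subsection \<open>The cylinder condition implies the second-order condition\<close>

lemma coord_sq_shift:
  "coord_sq u K z x = coord_sq u K z y +
     2 * (\<Sum>i\<in>K. (u i \<bullet> (y - z)) * (u i \<bullet> (x - y))) + coord_sq u K y x"
proof -
  have "u i \<bullet> (x - z) = u i \<bullet> (y - z) + u i \<bullet> (x - y)" for i
    by (simp add: inner_diff_right)
  then have "coord_sq u K z x = (\<Sum>i\<in>K. (u i \<bullet> (y - z))\<^sup>2 +
      2 * ((u i \<bullet> (y - z)) * (u i \<bullet> (x - y))) + (u i \<bullet> (x - y))\<^sup>2)"
    unfolding coord_sq_def by (simp only: power2_sum) (simp add: algebra_simps)
  then show ?thesis
    by (simp add: coord_sq_def sum.distrib sum_distrib_left)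
qed

lemma coord_sq_self [simp]: "coord_sq u K z z = 0"
  by (simp add: coord_sq_def)

text \<open>
  The cylinder has the axis plane through \<open>x0 + s p\<close>, and its other factor is a ball of radius
  \<open>s |p|\<close>, so that \<open>x0\<close> lies in its wall. For small \<open>s\<close> this ball beats the quadratic term
  \<open>M\<close>, and \<open>x0\<close> is the only point of the complement of \<open>U\<close> in the cylinder.
\<close>
lemma not_cond_C_touching:
  fixes u :: "'n::finite \<Rightarrow> real^'n"
  assumes \<Omega>: "open \<Omega>" and x0: "x0 \<in> \<Omega> - U" and u: "orthonormal_family u"
    and p: "p \<noteq> 0" "\<And>i. i \<in> K \<Longrightarrow> u i \<bullet> p = 0"
    and c: "0 < c" and M: "0 < M" and r: "0 < r"
    and bd: "\<And>x. x \<in> \<Omega> - U \<Longrightarrow> norm (x - x0) < r \<Longrightarrow>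
      p \<bullet> (x - x0) + c * coord_sq u K x0 x - M * coord_sq u (- K) x0 x \<le> 0"
  shows "\<not> cond_C (card K) \<Omega> U"
proof
  assume C: "cond_C (card K) \<Omega> U"
  obtain r1 where r1: "r1 > 0" "ball x0 r1 \<subseteq> \<Omega>"
    using \<Omega> x0 open_contains_ball by blast
  define r' where "r' = min r r1"
  have r': "0 < r'" "r' \<le> r" "r' \<le> r1" using r r1 by (auto simp: r'_def)
  \<comment> \<open>The first bound lets the curvature of the wall beat \<open>M\<close>. The
    second, with \<open>a\<close> equal to \<open>r' / 2\<close>, confines the cylinder: a point of
    it at distance D \<ge> \<open>r'\<close> from \<open>x0\<close> would satisfy D^2 \<le> (r' / 2)
    D.\<close>
  define s where "s = min (1 / (4 * M)) (r' / (8 * norm p))"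
  have np: "0 < norm p" using p by simp
  have s: "0 < s" using M r' np by (simp add: s_def)
  have sM: "4 * M * s \<le> 1"
    using M mult_left_mono[of s "1 / (4 * M)" "4 * M"] by (simp add: s_def)
  have sp: "8 * s * norm p \<le> r'"
    using np mult_right_mono[of s "r' / (8 * norm p)" "8 * norm p"] by (simp add: s_def mult.commute mult.left_commute)
  define z where "z = x0 + s *\<^sub>R p"
  define a where "a = r' / 2"
  define b where "b = s * norm p"
  have ab: "0 < a" "0 < b" using r' s np by (auto simp: a_def b_def)
  define Q :: "real^'n^'n" where "Q = (\<chi> i j. u j $ i)"
  have Q: "orthogonal_matrix Q"
    unfolding Q_def by (rule orthogonal_matrix_of_family[OF u])
  have col: "(\<lambda>i. column i Q) = u"
    by (simp add: Q_def column_def fun_eq_iff vec_eq_iff)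
  have YK: "coord_sq u K z x = coord_sq u K x0 x" for x
    unfolding coord_sq_def
    by (rule sum.cong) (auto simp: z_def inner_diff_right inner_add_right p)
  have WK: "coord_sq u (- K) z x = coord_sq u (- K) x0 x - 2 * s * (p \<bullet> (x - x0)) + b\<^sup>2" for x
  proof -
    have "(x - z) \<bullet> (x - z) = (x - x0) \<bullet> (x - x0) - 2 * s * (p \<bullet> (x - x0)) + b\<^sup>2"
    proof -
      have "p \<bullet> p = norm p * norm p"
        by (simp add: power2_norm_eq_inner[symmetric] power2_eq_square)
      moreover have "x - z = (x - x0) - s *\<^sub>R p" by (simp add: z_def)
      ultimately show ?thesis
        by (simp only: inner_diff_left inner_diff_right inner_scaleR_left inner_scaleR_right)
          (simp add: b_def power2_eq_square inner_commute algebra_simps)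
    qed
    then show ?thesis
      using coord_sq_add_compl[OF u, of K z x] coord_sq_add_compl[OF u, of K x0 x] YK[of x]
      by linarith
  qed
  \<comment> \<open>As \<open>b\<close> is the distance from \<open>z\<close> to \<open>x0\<close>,
    its square cancels. Writing W for the second quantity, the cylinder has p-height at least W / (2
    s), hence at least 2 M W, whereas the complement of \<open>U\<close> near \<open>x0\<close> has
    height at most M W.\<close>
  have cyl: "x \<in> cylinder z Q K a b \<longleftrightarrow>
      coord_sq u K x0 x \<le> a\<^sup>2 \<and> coord_sq u (- K) x0 x \<le> 2 * s * (p \<bullet> (x - x0))" for x
    using mem_cylinder_iff[OF Q, of a b x z K] ab by (simp add: col YK WK)
  have lat: "x \<in> lateral_boundary z Q K a b \<longleftrightarrow>
      coord_sq u K x0 x = a\<^sup>2 \<and> coord_sq u (- K) x0 x \<le> 2 * s * (p \<bullet> (x - x0))" for x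
    using mem_lateral_boundary_iff[OF Q, of a b x z K] ab by (simp add: col YK WK)
  have near: "norm (x - x0) < r'" if "x \<in> cylinder z Q K a b" for x
  proof (rule ccontr)
    assume "\<not> ?thesis"
    then have D: "r' \<le> norm (x - x0)" by simp
    let ?D = "norm (x - x0)"
    have "p \<bullet> (x - x0) \<le> norm p * ?D" by (rule norm_cauchy_schwarz)
    then have "2 * s * (p \<bullet> (x - x0)) \<le> 2 * s * (norm p * ?D)"
      using s by (intro mult_left_mono) auto
    then have "?D * ?D \<le> a\<^sup>2 + 2 * s * norm p * ?D"
      using that coord_sq_add_compl[OF u, of K x0 x]
      unfolding cyl by (simp add: power2_norm_eq_inner[symmetric] power2_eq_square)
    also have "\<dots> \<le> r' / 4 * ?D + r' / 4 * ?D"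
    proof (rule add_mono)
      show "a\<^sup>2 \<le> r' / 4 * ?D"
        using mult_left_mono[OF D, of "r' / 4"] r' by (simp add: a_def power2_eq_square)
      show "2 * s * norm p * ?D \<le> r' / 4 * ?D"
        using sp by (intro mult_right_mono) auto
    qed
    also have "\<dots> < r' * ?D"
    proof -
      have "0 < r' * ?D" by (rule mult_pos_pos) (use r' D in linarith)+
      then show ?thesis by (simp add: field_simps)
    qed
    also have "\<dots> \<le> ?D * ?D" using D by (intro mult_right_mono) auto
    finally show False by simp
  qed
  have sub: "cylinder z Q K a b \<subseteq> \<Omega>"
  proof
    fix x assume "x \<in> cylinder z Q K a b"
    from near[OF this] have "x \<in> ball x0 r1"
      using r' by (simp add: dist_norm norm_minus_commute)
    then show "x \<in> \<Omega>" using r1 by blast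
  qed
  have only: "x = x0" if x: "x \<in> cylinder z Q K a b" "x \<notin> U" for x
  proof -
    let ?Y = "coord_sq u K x0 x" and ?W = "coord_sq u (- K) x0 x" and ?t = "p \<bullet> (x - x0)"
    have YW: "0 \<le> ?Y" "0 \<le> ?W" by (simp_all add: coord_sq_nonneg)
    have W: "?W \<le> 2 * s * ?t" using x(1) cyl by blast
    have "x \<in> \<Omega> - U" "norm (x - x0) < r"
      using x sub near[OF x(1)] r' by auto
    then have le: "?t + c * ?Y - M * ?W \<le> 0" by (rule bd)
    have "0 \<le> (2 * s) * ?t" using YW(2) W by linarith
    then have t: "0 \<le> ?t" using s by (simp add: zero_le_mult_iff)
    have "2 * M * ?W \<le> 2 * M * (2 * s * ?t)"
      using W M by (intro mult_left_mono) auto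
    also have "\<dots> = 4 * M * s * ?t" by simp
    also have "\<dots> \<le> 1 * ?t" using sM t by (rule mult_right_mono)
    finally have "M * ?W + c * ?Y \<le> 0" using le by linarith
    moreover have "0 \<le> M * ?W" "0 \<le> c * ?Y" using M c YW by auto
    ultimately have "M * ?W = 0" "c * ?Y = 0" by linarith+
    then have "?W = 0" "?Y = 0" using M c by auto
    then have "(x - x0) \<bullet> (x - x0) = 0"
      using coord_sq_add_compl[OF u, of K x0 x] by linarith
    then show ?thesis by simp
  qed
  have x0C: "x0 \<in> cylinder z Q K a b" unfolding cyl by simp
  have x0I: "x0 \<notin> interior (cylinder z Q K a b)"
  proof
    assume "x0 \<in> interior (cylinder z Q K a b)"
    then obtain d where d: "d > 0" "ball x0 d \<subseteq> cylinder z Q K a b"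
      by (meson mem_interior)
    \<comment> \<open>A step against \<open>p\<close> makes the right side in \<open>cyl\<close>
      negative, so it leaves the cylinder.\<close>
    define t where "t = d / (2 * norm p)"
    have t: "0 < t" "t * norm p < d" using d np by (auto simp: t_def)
    have "x0 - t *\<^sub>R p \<in> ball x0 d" using t by (simp add: dist_norm)
    then have "coord_sq u (- K) x0 (x0 - t *\<^sub>R p) \<le> 2 * s * (p \<bullet> ((x0 - t *\<^sub>R p) - x0))"
      using d(2) cyl by blast
    moreover have "2 * s * (p \<bullet> ((x0 - t *\<^sub>R p) - x0)) < 0"
      using s t p by (simp add: mult_pos_pos)
    ultimately show False using coord_sq_nonneg[of u "- K" x0 "x0 - t *\<^sub>R p"] by linarith
  qed
  have "lateral_boundary z Q K a b \<union> interior (cylinder z Q K a b) \<subseteq> U"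
  proof
    fix x assume x: "x \<in> lateral_boundary z Q K a b \<union> interior (cylinder z Q K a b)"
    then have xC: "x \<in> cylinder z Q K a b"
      using lat[of x] cyl[of x] interior_subset by auto
    show "x \<in> U"
    proof (rule ccontr)
      assume "x \<notin> U"
      then have "x = x0" using only xC by blast
      then have "x0 \<in> lateral_boundary z Q K a b" using x x0I by blast
      then show False using lat[of x0] ab by simp
    qed
  qed
  then have "cylinder z Q K a b \<subseteq> U"
    using C Q ab sub unfolding cond_C_def by blast
  then show False using x0C x0 by blast
qed

text \<open>Projecting to a smaller subspace shortens. For the projection \<open>y\<close> of
  \<open>h\<close>, both \<open>y \<bullet> h\<close> and \<open>y \<bullet> y\<close> are the left
  side, so expanding the square of \<open>y - h\<close> in the coordinates from \<open>S\<close>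
  gives the bound.\<close>

lemma coord_sq_le_of_subspace:
  assumes u: "orthonormal_family u" and v: "orthonormal_family v"
    and sub: "\<And>i. i \<in> K \<Longrightarrow> v i \<in> span (u ` S)"
  shows "coord_sq v K z x \<le> coord_sq u S z x"
proof -
  define h where "h = x - z"
  define y where "y = (\<Sum>i\<in>K. (v i \<bullet> h) *\<^sub>R v i)"
  have vy: "v i \<bullet> y = (if i \<in> K then v i \<bullet> h else 0)" for i
    by (simp add: y_def orthonormal_coord_sum[OF v])
  have yh: "y \<bullet> h = coord_sq v K z x"
    by (simp add: y_def inner_sum_left coord_sq_def h_def power2_eq_square)
  have yy: "y \<bullet> y = coord_sq v K z x"
    unfolding orthonormal_inner[OF v, of y y] coord_sq_def h_def[symmetric]
    by (rule sum.mono_neutral_cong_right) (auto simp: vy power2_eq_square)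
  have "y \<in> span (u ` S)"
    unfolding y_def by (intro span_sum span_scale sub)
  then have uy: "u i \<bullet> y = 0" if "i \<notin> S" for i
    using span_orthonormal_coord[OF u] that by blast
  have inner: "y \<bullet> w = (\<Sum>i\<in>S. (u i \<bullet> y) * (u i \<bullet> w))" for w
    unfolding orthonormal_inner[OF u, of y w]
    by (rule sum.mono_neutral_cong_right) (auto simp: uy)
  have "0 \<le> (\<Sum>i\<in>S. (u i \<bullet> y - u i \<bullet> h)\<^sup>2)" by (simp add: sum_nonneg)
  also have "\<dots> = (\<Sum>i\<in>S. (u i \<bullet> y) * (u i \<bullet> y)) - 2 * (\<Sum>i\<in>S. (u i \<bullet> y) * (u i \<bullet> h))
      + (\<Sum>i\<in>S. (u i \<bullet> h)\<^sup>2)"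
    by (simp add: sum.distrib[symmetric] sum_subtractf[symmetric] sum_distrib_left
        power2_diff power2_eq_square algebra_simps)
  also have "\<dots> = y \<bullet> y - 2 * (y \<bullet> h) + coord_sq u S z x"
    unfolding inner coord_sq_def h_def ..
  finally show ?thesis using yh yy by linarith
qed

text \<open>A hyperplane costs one dimension, so at least \<open>k\<close> positive directions are
  orthogonal to \<open>p\<close>. Replacing the positive space by \<open>k\<close> of them preserves
  the bound: the part weighted by \<open>c\<close> shrinks, and the part weighted by
  \<open>- M\<close> grows.\<close>

lemma not_cond_C_gradient:
  fixes u :: "'n::finite \<Rightarrow> real^'n"
  assumes \<Omega>: "open \<Omega>" and x0: "x0 \<in> \<Omega> - U" and u: "orthonormal_family u"
    and S: "k < card S" and p: "p \<noteq> 0" and c: "0 < c" and M: "0 < M" and r: "0 < r"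
    and bd: "\<And>x. x \<in> \<Omega> - U \<Longrightarrow> norm (x - x0) < r \<Longrightarrow>
      p \<bullet> (x - x0) + c * coord_sq u S x0 x - M * coord_sq u (- S) x0 x \<le> 0"
  shows "\<not> cond_C k \<Omega> U"
proof -
  let ?V = "span (u ` S)" and ?H = "{y. p \<bullet> y = 0}"
  have "k \<le> dim (?V \<inter> ?H)"
  proof -
    have "dim {x + y |x y. x \<in> ?V \<and> y \<in> ?H} + dim (?V \<inter> ?H) = dim ?V + dim ?H"
      by (rule dim_sums_Int[OF subspace_span subspace_hyperplane])
    moreover have "dim {x + y |x y. x \<in> ?V \<and> y \<in> ?H} \<le> CARD('n)"
      using dim_subset_UNIV[of "{x + y |x y. x \<in> ?V \<and> y \<in> ?H}"] by simp
    moreover have "dim ?H = CARD('n) - 1"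
      using dim_hyperplane[OF p] by simp
    moreover have "dim ?V = card S"
      by (rule dim_span_orthonormal[OF u])
    ultimately show ?thesis using S by linarith
  qed
  then obtain Y where Y: "subspace Y" "Y \<subseteq> span (?V \<inter> ?H)" "dim Y = k"
    by (rule choose_subspace_of_subspace)
  have eq: "span (?V \<inter> ?H) = ?V \<inter> ?H"
    by (rule span_eq_iff[THEN iffD2, OF subspace_inter[OF subspace_span subspace_hyperplane]])
  have YVH: "Y \<subseteq> ?V" "Y \<subseteq> ?H" using Y(2)[unfolded eq] by blast+
  obtain v K where v: "orthonormal_family v" "card K = dim Y" "\<And>i. i \<in> K \<Longrightarrow> v i \<in> Y"
    using orthonormal_family_adapted[OF Y(1)] by metis
  have vp: "v i \<bullet> p = 0" if "i \<in> K" for i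
    using v(3)[OF that] YVH by (auto simp: inner_commute)
  have le: "coord_sq v K z x \<le> coord_sq u S z x" for z x
    by (rule coord_sq_le_of_subspace[OF u v(1)]) (use v(3) YVH in blast)
  have "\<not> cond_C (card K) \<Omega> U"
  proof (rule not_cond_C_touching[OF \<Omega> x0 v(1) p vp c M r])
    fix x assume x: "x \<in> \<Omega> - U" "norm (x - x0) < r"
    have "coord_sq u (- S) x0 x \<le> coord_sq v (- K) x0 x"
      using le[of x0 x] coord_sq_add_compl[OF u, of S x0 x] coord_sq_add_compl[OF v(1), of K x0 x]
      by linarith
    then have "M * coord_sq u (- S) x0 x \<le> M * coord_sq v (- K) x0 x"
      using M by simp
    moreover have "c * coord_sq v K x0 x \<le> c * coord_sq u S x0 x"
      using le c by simp
    ultimately show "p \<bullet> (x - x0) + c * coord_sq v K x0 x - M * coord_sq v (- K) x0 x \<le> 0"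
      using bd[OF x] by linarith
  qed
  then show ?thesis using v Y by simp
qed

text \<open>
  Shifting the centre of the positive part of the quadratic form by \<open>\<delta>\<close> moves the maximum on the
  complement of \<open>U\<close> to a point where the form is positive, hence where its gradient does not vanish.
\<close>
lemma not_cond_C_critical:
  fixes u :: "'n::finite \<Rightarrow> real^'n"
  assumes \<Omega>: "open \<Omega>" and U: "open U" and x0: "x0 \<in> \<Omega> - U" and u: "orthonormal_family u"
    and S: "k < card S" and c: "0 < c" and M: "0 < M" and r: "0 < r" and \<eta>: "0 < \<eta>"
    and bd: "\<And>x. x \<in> \<Omega> - U \<Longrightarrow> norm (x - x0) < r \<Longrightarrow>
      c * coord_sq u S x0 x - M * coord_sq u (- S) x0 x \<le> - \<eta> * ((x - x0) \<bullet> (x - x0))"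
  shows "\<not> cond_C k \<Omega> U"
proof -
  obtain r1 where r1: "r1 > 0" "ball x0 r1 \<subseteq> \<Omega>"
    using \<Omega> x0 open_contains_ball by blast
  \<comment> \<open>Halving makes both comparisons strict, so that \<open>bd\<close> holds on the
    bounding sphere and the closed ball lies in \<Omega>.\<close>
  define r' where "r' = min r r1 / 2"
  have r': "0 < r'" "r' < r" "r' < r1" using r r1 by (auto simp: r'_def)
  have "cball x0 r' \<subseteq> ball x0 r1" using r' by (simp add: cball_subset_ball_iff)
  then have cb: "cball x0 r' \<subseteq> \<Omega>" using r1 by blast
  obtain i0 where i0: "i0 \<in> S" using S by (metis card.empty equals0I not_less_zero)
  have e1: "norm (u i0) = 1" using u by (simp add: orthonormal_family_def norm_eq_1)
  \<comment> \<open>On the sphere of radius \<open>r'\<close> the shift gains at most 2 c \<delta>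
    r' = \<eta> r'^2 / 2 over \<open>q x0\<close>, half of the loss granted by \<open>bd\<close>.
    Hence the maximum is attained inside.\<close>
  define \<delta> where "\<delta> = \<eta> * r' / (4 * c)"
  have \<delta>: "0 < \<delta>" "4 * c * \<delta> = \<eta> * r'" using \<eta> r' c by (auto simp: \<delta>_def)
  define xc where "xc = x0 + \<delta> *\<^sub>R u i0"
  define q where "q x = c * coord_sq u S xc x - M * coord_sq u (- S) xc x" for x
  have uxc: "u i \<bullet> (x0 - xc) = (if i = i0 then - \<delta> else 0)" for i
    using u by (simp add: xc_def orthonormal_family_def)
  have qx: "q x = c * coord_sq u S x0 x - M * coord_sq u (- S) x0 x
      - 2 * c * \<delta> * (u i0 \<bullet> (x - x0)) + c * \<delta>\<^sup>2" for x
  proof -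
    have 1: "coord_sq u S xc x0 = \<delta>\<^sup>2" "coord_sq u (- S) xc x0 = 0"
      using i0 by (auto simp: coord_sq_def uxc if_distrib[of "\<lambda>t. t\<^sup>2"] cong: if_cong intro!: sum.neutral)
    have 2: "(\<Sum>i\<in>S. (u i \<bullet> (x0 - xc)) * (u i \<bullet> (x - x0))) = - \<delta> * (u i0 \<bullet> (x - x0))"
      "(\<Sum>i\<in>- S. (u i \<bullet> (x0 - xc)) * (u i \<bullet> (x - x0))) = 0"
      using i0 by (auto simp: uxc if_distrib[of "\<lambda>t. t * _"] cong: if_cong intro!: sum.neutral)
    show ?thesis
      unfolding q_def coord_sq_shift[of u _ xc x x0] 1 2 by (simp add: algebra_simps)
  qed
  have qx0: "q x0 = c * \<delta>\<^sup>2" by (simp add: qx)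
  let ?T = "cball x0 r' - U"
  have "compact ?T" by (rule compact_diff[OF compact_cball U])
  moreover have x0T: "x0 \<in> ?T" using x0 r' by simp
  then have "?T \<noteq> {}" by blast
  moreover have "continuous_on ?T q" unfolding q_def by (intro continuous_intros)
  ultimately obtain x1 where x1: "x1 \<in> ?T" and max1: "\<forall>x\<in>?T. q x \<le> q x1"
    using continuous_attains_sup[of ?T q] by blast
  have q1: "c * \<delta>\<^sup>2 \<le> q x1" using max1 x0T qx0 by force
  have x1F: "x1 \<in> \<Omega> - U" using x1 cb by blast
  have x1n: "norm (x1 - x0) < r'"
  proof (rule ccontr)
    assume "\<not> ?thesis"
    then have n: "norm (x1 - x0) = r'" using x1 by (simp add: dist_norm norm_minus_commute)
    then have sq: "(x1 - x0) \<bullet> (x1 - x0) = r'\<^sup>2" by (simp add: power2_norm_eq_inner[symmetric])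
    have "- (u i0 \<bullet> (x1 - x0)) \<le> r'"
      using Cauchy_Schwarz_ineq2[of "u i0" "x1 - x0"] e1 n by simp
    then have "2 * c * \<delta> * (- (u i0 \<bullet> (x1 - x0))) \<le> 2 * c * \<delta> * r'"
      using c \<delta> by (intro mult_left_mono) auto
    moreover have "c * coord_sq u S x0 x1 - M * coord_sq u (- S) x0 x1 \<le> - \<eta> * r'\<^sup>2"
      using bd[OF x1F] n r' sq by simp
    ultimately have "q x1 \<le> - \<eta> * r'\<^sup>2 + 2 * c * \<delta> * r' + c * \<delta>\<^sup>2"
      using qx[of x1] by linarith
    also have "2 * c * \<delta> * r' = \<eta> * r'\<^sup>2 / 2"
      using \<delta>(2) by (simp add: power2_eq_square)
    finally have "\<eta> * r'\<^sup>2 \<le> 0" using q1 by simp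
    then show False using \<eta> r' by (simp add: mult_le_0_iff)
  qed
  \<comment> \<open>The gradient of \<open>q\<close> at \<open>x1\<close>.\<close>
  define p where "p = (\<Sum>i\<in>UNIV. (2 * (if i \<in> S then c else - M) * (u i \<bullet> (x1 - xc))) *\<^sub>R u i)"
  have up: "u i \<bullet> p = 2 * (if i \<in> S then c else - M) * (u i \<bullet> (x1 - xc))" for i
    by (simp only: p_def orthonormal_coord_sum[OF u]) simp
  \<comment> \<open>The gradient vanishes only at the centre \<open>xc\<close>, where
    \<open>q\<close> is 0. But \<open>q x1\<close> is at least \<open>q x0\<close>, which is
    positive because the shift is along a direction in \<open>S\<close>.\<close>
  have p0: "p \<noteq> 0"
  proof
    assume "p = 0"
    then have "u i \<bullet> (x1 - xc) = 0" for i
      using up[of i] c M by (auto split: if_splits)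
    then have "q x1 = 0" by (simp add: q_def coord_sq_def)
    moreover have "0 < c * \<delta>\<^sup>2" using c \<delta>(1) by simp
    ultimately show False using q1 by linarith
  qed
  \<comment> \<open>For a quadratic function the Taylor expansion at \<open>x1\<close> is exact, so
    the bound required in the gradient case is just the maximality of \<open>x1\<close>.\<close>
  have px: "p \<bullet> (x - x1) + c * coord_sq u S x1 x - M * coord_sq u (- S) x1 x = q x - q x1" for x
  proof -
    have "p \<bullet> (x - x1) =
        (\<Sum>i\<in>S \<union> - S. (2 * (if i \<in> S then c else - M) * (u i \<bullet> (x1 - xc))) * (u i \<bullet> (x - x1)))"
      by (simp add: p_def inner_sum_left)
    also have "\<dots> = 2 * c * (\<Sum>i\<in>S. (u i \<bullet> (x1 - xc)) * (u i \<bullet> (x - x1)))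
        - 2 * M * (\<Sum>i\<in>- S. (u i \<bullet> (x1 - xc)) * (u i \<bullet> (x - x1)))"
      by (subst sum.union_disjoint) (auto simp: sum_distrib_left sum_negf[symmetric] mult.assoc)
    finally show ?thesis
      unfolding q_def coord_sq_shift[of u _ xc x x1] by (simp add: algebra_simps)
  qed
  have "0 < r' - norm (x1 - x0)" using x1n by simp
  then show ?thesis
  proof (rule not_cond_C_gradient[OF \<Omega> x1F u S p0 c M])
    fix x assume x: "x \<in> \<Omega> - U" "norm (x - x1) < r' - norm (x1 - x0)"
    have "norm (x - x0) \<le> norm (x - x1) + norm (x1 - x0)"
      using norm_triangle_ineq[of "x - x1" "x1 - x0"] by simp
    then have "x \<in> ?T" using x by (simp add: dist_norm norm_minus_commute)
    then show "p \<bullet> (x - x1) + c * coord_sq u S x1 x - M * coord_sq u (- S) x1 x \<le> 0"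
      unfolding px using max1 by simp
  qed
qed

theorem cond_C_imp_cond_G:
  fixes \<Omega> U :: "(real^'n) set"
  assumes \<Omega>: "open \<Omega>" and U: "open U" and k: "k < CARD('n)" and C: "cond_C k \<Omega> U"
  shows "cond_G (CARD('n) - k) \<Omega> U"
  unfolding cond_G_def
proof (intro allI impI, elim conjE, rule ccontr)
  fix \<phi> x0
  assume C2: "C2_on \<Omega> \<phi>" and x0: "x0 \<in> \<Omega> - U" and max0: "\<forall>y\<in>\<Omega> - U. \<phi> y \<le> \<phi> x0"
    and "\<phi> x0 = 0" and "\<not> eigval (CARD('n) - k) (hessian \<phi> x0) \<le> 0"
  then have pos: "0 < eigval (CARD('n) - k) (hessian \<phi> x0)" by simp
  have x0\<Omega>: "x0 \<in> \<Omega>" using x0 by simp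
  let ?H = "hessian \<phi> x0"
  have sym: "transpose ?H = ?H" by (rule C2_on_taylor(1)[OF C2 \<Omega> x0\<Omega>])
  obtain u d where u: "orthonormal_family u" and d: "\<And>i. ?H *v u i = d i *\<^sub>R u i"
    using symmetric_matrix_spectral[OF sym] by metis
  define S where "S = {i. d i > 0}"
  have S: "k < card S" using pos eigval_pos_iff[OF u d k] by (simp add: S_def)
  then have ne: "S \<noteq> {}" by auto
  define m where "m = Min (d ` S)"
  have m: "0 < m" "\<And>i. i \<in> S \<Longrightarrow> m \<le> d i"
    using ne by (auto simp: m_def S_def)
  \<comment> \<open>Unlike a minimum over \<open>- S\<close>, this also makes sense when
    \<open>S\<close> is everything.\<close>
  define D where "D = (\<Sum>i\<in>UNIV. \<bar>d i\<bar>)"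
  have D: "0 \<le> D" "- D \<le> d i" for i
    using member_le_sum[of i UNIV "\<lambda>i. \<bar>d i\<bar>"] by (auto simp: D_def sum_nonneg)
  have uH: "u i \<bullet> (?H *v h) = d i * (u i \<bullet> h)" for i h
    by (simp add: symmetric_matrix_inner[OF sym] d)
  have form: "m * coord_sq u S x0 x - D * coord_sq u (- S) x0 x \<le> (x - x0) \<bullet> (?H *v (x - x0))" for x
  proof -
    have "(x - x0) \<bullet> (?H *v (x - x0)) = (\<Sum>i\<in>S \<union> - S. d i * (u i \<bullet> (x - x0))\<^sup>2)"
      unfolding orthonormal_inner[OF u, of "x - x0" "?H *v (x - x0)"] uH
      by (simp add: power2_eq_square mult.left_commute)
    also have "\<dots> = (\<Sum>i\<in>S. d i * (u i \<bullet> (x - x0))\<^sup>2) + (\<Sum>i\<in>- S. d i * (u i \<bullet> (x - x0))\<^sup>2)"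
      by (rule sum.union_disjoint) auto
    also have "\<dots> \<ge> (\<Sum>i\<in>S. m * (u i \<bullet> (x - x0))\<^sup>2) + (\<Sum>i\<in>- S. (- D) * (u i \<bullet> (x - x0))\<^sup>2)"
      by (intro add_mono sum_mono mult_right_mono m D) auto
    finally show ?thesis
      by (simp add: coord_sq_def sum_distrib_left sum_negf)
  qed
  define p where "p = (\<chi> i. partial i \<phi> x0)"
  \<comment> \<open>The Taylor formula halves the form, leaving \<open>m / 2\<close> on
    \<open>S\<close>; an error of \<open>m / 4\<close> preserves a positive coefficient
    \<open>m / 4\<close>.\<close>
  have m4: "0 < m / 4" using m by simp
  obtain r where r: "0 < r" "\<And>h. norm h < r \<Longrightarrow>
      \<bar>\<phi> (x0 + h) - \<phi> x0 - p \<bullet> h - h \<bullet> (?H *v h) / 2\<bar> \<le> m / 4 * (h \<bullet> h)"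
    using C2_on_taylor(2)[OF C2 \<Omega> x0\<Omega> m4] unfolding p_def by blast
  define M where "M = D / 2 + m / 4"
  have M: "0 < M" using m D by (simp add: M_def add_nonneg_pos)
  have bd: "p \<bullet> (x - x0) + m / 4 * coord_sq u S x0 x - M * coord_sq u (- S) x0 x \<le> 0"
    if x: "x \<in> \<Omega> - U" "norm (x - x0) < r" for x
  proof -
    have "\<phi> x \<le> \<phi> x0" using max0 x by blast
    moreover have "x0 + (x - x0) = x" by simp
    note r(2)[OF x(2), unfolded this]
    ultimately have "p \<bullet> (x - x0) + (x - x0) \<bullet> (?H *v (x - x0)) / 2 \<le> m / 4 * ((x - x0) \<bullet> (x - x0))"
      by linarith
    moreover have "m / 4 * ((x - x0) \<bullet> (x - x0)) =
        m / 4 * coord_sq u S x0 x + m / 4 * coord_sq u (- S) x0 x"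
      by (simp only: coord_sq_add_compl[OF u, of S, symmetric] distrib_left)
    moreover have "M * coord_sq u (- S) x0 x =
        D * coord_sq u (- S) x0 x / 2 + m / 4 * coord_sq u (- S) x0 x"
      by (simp add: M_def distrib_right)
    ultimately show ?thesis
      using form[of x] by linarith
  qed
  have "\<not> cond_C k \<Omega> U"
  proof (cases "p = 0")
    case False
    show ?thesis by (rule not_cond_C_gradient[OF \<Omega> x0 u S False m4 M r(1) bd])
  next
    case True
    \<comment> \<open>Half of the coefficient \<open>m / 4\<close> is given up to obtain the strict
      decrease that the translation argument consumes; in the other directions the same amount is
      added to \<open>M\<close>.\<close>
    have m8: "0 < m / 8" "0 < M + m / 8" using m M by auto
    show ?thesis
    proof (rule not_cond_C_critical[OF \<Omega> U x0 u S m8(1) m8(2) r(1) m8(1)])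
      fix x assume "x \<in> \<Omega> - U" "norm (x - x0) < r"
      from bd[OF this] have "m / 4 * coord_sq u S x0 x - M * coord_sq u (- S) x0 x \<le> 0"
        using True by simp
      then show "m / 8 * coord_sq u S x0 x - (M + m / 8) * coord_sq u (- S) x0 x
          \<le> - (m / 8) * ((x - x0) \<bullet> (x - x0))"
        unfolding coord_sq_add_compl[OF u, of S, symmetric]
        by (simp add: algebra_simps)
    qed
  qed
  then show False using C by blast
qed

theorem theorem6:
  fixes \<Omega> U :: "(real^'n) set" and k :: nat
  assumes "open \<Omega>" and "open U" and "U \<subseteq> \<Omega>"
    and "1 \<le> k" and "k < CARD('n)"
  shows "cond_C k \<Omega> U \<longleftrightarrow> cond_G (CARD('n) - k) \<Omega> U"
  using cond_C_imp_cond_G[OF assms(1,2,5)] cond_G_imp_cond_C[OF assms(1,2)] by blast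

end
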